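(* Let $(S_n)_{n\ge 0}$ be the $M(2,2)$-random walk on $\mathbb{Z}^4$. Then $(S_n)_{n\ge 0}$ is transient, i.e. almost surely every site $z\in\mathbb{Z}^4$ is visited only finitely many times: almost surely, for every $z\in\mathbb{Z}^4$, the set $\{n\ge 0 : S_n=z\}$ is finite.
   Context: The $M(2,2)$-random walk is the nearest-neighbor process $S_n=(X_n,Y_n)$ on $\mathbb{Z}^4=\mathbb{Z}^2\times\mathbb{Z}^2$, where $X_n\in\mathbb{Z}^2$ denotes the first two coordinates of $S_n$ and $Y_n\in\mathbb{Z}^2$ the last two, defined as follows. $S_0=0$. Let $\mathcal{F}_n=\sigma(S_0,\dots,S_n)$ and let $e_1,\dots,e_4$ be the standard basis of $\mathbb{Z}^4$. If the walk is at its site for the first time at time $n$, i.e. $S_n\notin\{S_0,\dots,S_{n-1}\}$ (in particular for $n=0$), then only $X$ performs a simple random walk step: $\mathbb{P}[S_{n+1}-S_n=\pm e_i\mid\mathcal{F}_n]=1/4$ for each of the four vectors $\pm e_i$, $i\in\{1,2\}$. If $S_n$ has already been visited, i.e. $S_n\in\{S_0,\dots,S_{n-1}\}$, then only $Y$ performs a simple random walk step: $\mathbb{P}[S_{n+1}-S_n=\pm e_i\mid\mathcal{F}_n]=1/4$ for each of the four vectors $\pm e_i$, $i\in\{3,4\}$. *)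

theory Defs
  imports "HOL-Probability.Probability"
begin

text \<open>
  The lattice \<open>\<int>\<^sup>4\<close> is the type \<open>int ^ 4\<close>. Its index type \<open>4\<close> has exactly the four distinct
  elements \<open>1, 2, 3, 4\<close> (where \<open>4 = 0\<close>). Coordinates \<open>1, 2\<close> form the \<open>X\<close>-part and
  coordinates \<open>3, 4\<close> the \<open>Y\<close>-part of a site; \<open>axis i 1\<close> is the basis vector \<open>e\<^sub>i\<close>.
\<close>

definition unit_steps :: "4 set \<Rightarrow> (int ^ 4) set" where
  "unit_steps I = (\<Union>i\<in>I. {axis i 1, - axis i 1})"

definition hist_algebra :: "'a measure \<Rightarrow> (nat \<Rightarrow> 'a \<Rightarrow> 'b) \<Rightarrow> nat \<Rightarrow> 'a measure" where
  "hist_algebra M S n = sigma (space M) {S k -` A \<inter> space M | k A. k \<le> n}"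

lemma subalgebra_hist_algebra:
  assumes "\<And>n. S n \<in> measurable M (count_space UNIV)"
  shows "subalgebra M (hist_algebra M S n)"
proof -
  have "{S k -` A \<inter> space M | k A. k \<le> n} \<subseteq> sets M"
    using measurable_sets[OF assms] by auto
  then show ?thesis
    unfolding subalgebra_def hist_algebra_def
    by (auto simp: space_measure_of_conv sets_measure_of_conv intro: sets.sigma_sets_subset[THEN subsetD])
qed

definition first_visit :: "(nat \<Rightarrow> 'a \<Rightarrow> 'b) \<Rightarrow> nat \<Rightarrow> 'a \<Rightarrow> bool" where
  "first_visit S n \<omega> \<longleftrightarrow> S n \<omega> \<notin> (\<lambda>k. S k \<omega>) ` {..<n}"

text \<open>
  The conditional probability of an event given \<open>\<F>\<^sub>n\<close> is the conditional expectation of its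
  indicator; being determined only up to null sets, its value is prescribed almost surely.
\<close>

definition step_prob ::
  "'a measure \<Rightarrow> (nat \<Rightarrow> 'a \<Rightarrow> int ^ 4) \<Rightarrow> nat \<Rightarrow> int ^ 4 \<Rightarrow> 'a \<Rightarrow> real" where
  "step_prob M S n v =
     real_cond_exp M (hist_algebra M S n)
       (indicator {\<omega> \<in> space M. S (Suc n) \<omega> - S n \<omega> = v})"

locale M22_random_walk = prob_space M
  for M :: "'a measure" and S :: "nat \<Rightarrow> 'a \<Rightarrow> int ^ 4" +
  assumes measurable_walk: "\<And>n. S n \<in> measurable M (count_space UNIV)"
    and start: "AE \<omega> in M. S 0 \<omega> = 0"
    and step_first_visit:
      "\<And>n v. v \<in> unit_steps {1, 2} \<Longrightarrow>
         AE \<omega> in M. first_visit S n \<omega> \<longrightarrow> step_prob M S n v \<omega> = 1 / 4"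
    and step_revisit:
      "\<And>n v. v \<in> unit_steps {3, 4} \<Longrightarrow>
         AE \<omega> in M. \<not> first_visit S n \<omega> \<longrightarrow> step_prob M S n v \<omega> = 1 / 4"

end

theory Submission
  imports Defs "HOL-Real_Asymp.Real_Asymp"
begin

text \<open>
  If \<open>r\<close> is the number of first visits before time \<open>m\<close>, then \<open>S\<^sub>m = U\<^sub>r + V\<^bsub>m - r\<^esub>\<close> for two independent
  planar simple random walks \<open>U\<close> and \<open>V\<close>. Two deterministic facts make both \<open>r\<close> and \<open>m - r\<close> large when
  \<open>m\<close> is of order \<open>n = 2\<^sup>p\<close>. Distinct values of \<open>V\<close> give distinct sites, so \<open>r\<close> is at least the range of
  \<open>V\<close> up to time \<open>m - r\<close>; by Cauchy--Schwarz and a first moment bound on the number of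
  self-intersections this range is at least \<open>n / p\<^sup>3\<close> up to probability \<open>O(p\<^bsup>-2\<^esup>)\<close>. Conversely, whenever \<open>U\<close>
  steps back, \<open>U\<^bsub>2l+2\<^esub> = U\<^bsub>2l\<^esub>\<close>, some old site is revisited between these two steps, so \<open>m - r\<close> is at least of
  order \<open>n\<close> up to an exponentially small probability. Hence a visit to \<open>z\<close> in \<open>[n, 2n]\<close> forces \<open>U\<close> to hit a
  given point during \<open>[n / p\<^sup>3, 2n]\<close> and \<open>V\<close> during \<open>[c n, 2n]\<close>. As \<open>P(U\<^sub>m = y) \<le> 1 / (m + 1)\<close> and the Green
  function up to time \<open>n\<close> is at least of order \<open>p\<close>, these independent events have
  probabilities \<open>O(log p / p)\<close> and \<open>O(1 / p)\<close>. The product is summable, and Borel--Cantelli applies.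
\<close>

section \<open>Averages over finite sequences of steps\<close>

text \<open>Expectation under the uniform law on lists of length \<open>n\<close> over
  \<open>D\<close>. Recursion on the first entry turns first-step analysis into plain induction,
  without product measures.\<close>

primrec mean :: "'b set \<Rightarrow> nat \<Rightarrow> ('b list \<Rightarrow> real) \<Rightarrow> real" where
  "mean D 0 f = f []"
| "mean D (Suc n) f = (\<Sum>a\<in>D. mean D n (\<lambda>xs. f (a # xs))) / card D"

lemma mean_mono:
  assumes "\<And>xs. length xs = n \<Longrightarrow> set xs \<subseteq> D \<Longrightarrow> f xs \<le> g xs"
  shows "mean D n f \<le> mean D n g"
  using assms by (induction n arbitrary: f g) (auto intro!: divide_right_mono sum_mono)

lemma mean_cong:
  assumes "\<And>xs. length xs = n \<Longrightarrow> set xs \<subseteq> D \<Longrightarrow> f xs = g xs"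
  shows "mean D n f = mean D n g"
  using assms by (intro antisym mean_mono) auto

lemma mean_add: "mean D n (\<lambda>xs. f xs + g xs) = mean D n f + mean D n g"
  by (induction n arbitrary: f g) (simp_all add: sum.distrib add_divide_distrib)

lemma mean_cmult: "mean D n (\<lambda>xs. c * f xs) = c * mean D n f"
  by (induction n arbitrary: f) (simp_all add: sum_distrib_left [symmetric])

lemma mean_cmult_right: "mean D n (\<lambda>xs. f xs * c) = mean D n f * c"
  using mean_cmult [of D n c f] by (simp add: mult.commute)

lemma mean_divide: "mean D n (\<lambda>xs. f xs / c) = mean D n f / c"
  using mean_cmult_right [of D n f "inverse c"] by (simp add: divide_inverse)

lemma mean_zero [simp]: "mean D n (\<lambda>_. 0) = 0"
  by (induction n) simp_all

lemma mean_const: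
  assumes "finite D" "D \<noteq> {}"
  shows "mean D n (\<lambda>_. c) = c"
  using assms by (induction n) simp_all

lemma mean_sum: "mean D n (\<lambda>xs. \<Sum>i\<in>I. f i xs) = (\<Sum>i\<in>I. mean D n (f i))"
  by (induction I rule: infinite_finite_induct) (simp_all add: mean_add)

lemma mean_nonneg:
  assumes "\<And>xs. 0 \<le> f xs"
  shows "0 \<le> mean D n f"
  using mean_mono [of n D "\<lambda>_. 0" f] assms by simp

text \<open>Independence of the initial and the final segment of a uniform list, in the form of
  Fubini's theorem.\<close>

lemma mean_append:
  "mean D (m + n) f = mean D m (\<lambda>xs. mean D n (\<lambda>ys. f (xs @ ys)))"
  by (induction m arbitrary: f) simp_all

lemma mean_take:
  assumes "finite D" "D \<noteq> {}" "n \<le> N"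
  shows "mean D N (\<lambda>xs. f (take n xs)) = mean D n f"
proof -
  obtain k where N: "N = n + k"
    using assms le_Suc_ex by blast
  have "mean D N (\<lambda>xs. f (take n xs)) = mean D n (\<lambda>xs. mean D k (\<lambda>ys. f (take n (xs @ ys))))"
    by (simp add: N mean_append)
  also have "\<dots> = mean D n (\<lambda>xs. mean D k (\<lambda>ys. f xs))"
    by (intro mean_cong) simp
  finally show ?thesis
    using assms by (simp add: mean_const)
qed

lemma mean_drop_take:
  assumes "finite D" "D \<noteq> {}" "m + n \<le> N"
  shows "mean D N (\<lambda>xs. f (take n (drop m xs))) = mean D n f"
proof -
  obtain k where N: "N = m + k" "n \<le> k"
    using assms le_Suc_ex by (metis nat_add_left_cancel_le add_leD1)
  have "mean D N (\<lambda>xs. f (take n (drop m xs))) =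
      mean D m (\<lambda>xs. mean D k (\<lambda>ys. f (take n (drop m (xs @ ys)))))"
    by (simp add: N mean_append)
  also have "\<dots> = mean D m (\<lambda>xs. mean D k (\<lambda>ys. f (take n ys)))"
    by (intro mean_cong) simp
  finally show ?thesis
    using assms N by (simp add: mean_const mean_take)
qed

lemma mean_markov:
  assumes "\<And>xs. 0 \<le> f xs" "t > 0"
  shows "mean D n (\<lambda>xs. of_bool (t \<le> f xs)) \<le> mean D n f / t"
  unfolding mean_divide [symmetric] using assms by (intro mean_mono) (auto simp: field_simps)

section \<open>Partial sums, transition probabilities and hitting times\<close>

definition partial_sum :: "'g::comm_monoid_add list \<Rightarrow> nat \<Rightarrow> 'g" where
  "partial_sum xs n = sum_list (take n xs)"

lemma partial_sum_0 [simp]: "partial_sum xs 0 = 0"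
  by (simp add: partial_sum_def)

lemma partial_sum_Cons [simp]: "partial_sum (x # xs) (Suc n) = x + partial_sum xs n"
  by (simp add: partial_sum_def)

lemma partial_sum_Suc:
  "n < length xs \<Longrightarrow> partial_sum xs (Suc n) = partial_sum xs n + xs ! n"
  by (simp add: partial_sum_def take_Suc_conv_app_nth)

text \<open>The \<open>n\<close>-step transition probability from 0 to \<open>y\<close> of the walk
  with uniform steps in \<open>D\<close>.\<close>

definition kernel :: "'g::ab_group_add set \<Rightarrow> nat \<Rightarrow> 'g \<Rightarrow> real" where
  "kernel D n y = mean D n (\<lambda>xs. of_bool (sum_list xs = y))"

lemma kernel_0: "kernel D 0 y = of_bool (y = 0)"
  by (auto simp: kernel_def)

lemma kernel_Suc: "kernel D (Suc n) y = (\<Sum>s\<in>D. kernel D n (y - s)) / card D"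
  by (simp add: kernel_def eq_diff_eq add.commute)

lemma kernel_nonneg: "0 \<le> kernel D n y"
  unfolding kernel_def by (intro mean_nonneg) simp

text \<open>A first-step induction on \<open>b\<close> takes the place of the strong Markov property at the hitting time.\<close>

lemma hit_prob_le:
  fixes D :: "'g::ab_group_add set"
  assumes "finite D" "D \<noteq> {}"
  shows "mean D b (\<lambda>xs. of_bool (\<exists>m\<in>{a..b}. partial_sum xs m = y)) * (\<Sum>l\<le>c. kernel D l 0)
         \<le> (\<Sum>m=a..b + c. kernel D m y)"
proof (induction b arbitrary: a y)
  case 0
  show ?case
  proof (cases "a = 0 \<and> y = 0")
    case True
    then show ?thesis
      by (simp add: atMost_atLeast0)
  next
    case False
    then show ?thesis
      by (auto simp: sum_nonneg kernel_nonneg)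
  qed
next
  case (Suc b)
  let ?G = "\<Sum>l\<le>c. kernel D l 0"
  have G0: "0 \<le> ?G"
    by (simp add: sum_nonneg kernel_nonneg)
  show ?case
  proof (cases "a = 0 \<and> y = 0")
    case True
    \<comment> \<open>Time 0 is already a hit, so bounding the probability by 1 suffices.\<close>
    have "mean D (Suc b) (\<lambda>xs. of_bool (\<exists>m\<in>{a..Suc b}. partial_sum xs m = y)) * ?G
        \<le> mean D (Suc b) (\<lambda>xs. 1) * ?G"
      using G0 by (intro mult_right_mono mean_mono) auto
    also have "\<dots> = (\<Sum>l\<in>{0..c}. kernel D l 0)"
      using assms mean_const[of D "Suc b" 1] by (simp del: mean.simps add: atMost_atLeast0)
    also have "\<dots> \<le> (\<Sum>m=a..Suc b + c. kernel D m y)"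
      unfolding conjunct1 [OF True] conjunct2 [OF True]
      by (intro sum_mono2) (auto simp: kernel_nonneg)
    finally show ?thesis .
  next
    case False
    \<comment> \<open>No hit inside the window occurs at time 0, so the first step can be split off.
      Truncated subtraction is right here: for \<open>a = 0\<close> a hit happens at time 1 or
      later, so after the shift the window again starts at 0.\<close>
    have *: "(\<exists>m\<in>{a..Suc b}. partial_sum (s # xs) m = y) \<longleftrightarrow>
        (\<exists>m\<in>{a - 1..b}. partial_sum xs m = y - s)" for s and xs :: "'g list"
    proof
      assume "\<exists>m\<in>{a..Suc b}. partial_sum (s # xs) m = y"
      then obtain m where m: "m \<in> {a..Suc b}" "partial_sum (s # xs) m = y"
        by blast
      with False have "m \<noteq> 0" by (cases m) auto
      then obtain k where "m = Suc k" by (cases m) auto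
      with m show "\<exists>m\<in>{a - 1..b}. partial_sum xs m = y - s"
        by (intro bexI [of _ k]) (auto simp: algebra_simps)
    next
      assume "\<exists>m\<in>{a - 1..b}. partial_sum xs m = y - s"
      then obtain m where "m \<in> {a - 1..b}" "partial_sum xs m = y - s"
        by blast
      then show "\<exists>m\<in>{a..Suc b}. partial_sum (s # xs) m = y"
        by (intro bexI [of _ "Suc m"]) (auto simp: algebra_simps)
    qed
    have "mean D (Suc b) (\<lambda>xs. of_bool (\<exists>m\<in>{a..Suc b}. partial_sum xs m = y)) * ?G
       = (\<Sum>s\<in>D. mean D b (\<lambda>xs. of_bool (\<exists>m\<in>{a - 1..b}. partial_sum xs m = y - s)) * ?G) / card D"
      by (simp only: mean.simps * sum_distrib_right [symmetric] times_divide_eq_left)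
    also have "\<dots> \<le> (\<Sum>s\<in>D. \<Sum>m=a - 1..b + c. kernel D m (y - s)) / card D"
      by (intro divide_right_mono sum_mono Suc.IH) simp
    also have "\<dots> = (\<Sum>m=a - 1..b + c. kernel D (Suc m) y)"
      by (subst sum.swap) (simp add: kernel_Suc sum_divide_distrib)
    also have "\<dots> = (\<Sum>m\<in>Suc ` {a - 1..b + c}. kernel D m y)"
      by (subst sum.reindex) auto
    also have "\<dots> \<le> (\<Sum>m=a..Suc b + c. kernel D m y)"
      by (intro sum_mono2) (auto simp: kernel_nonneg)
    finally show ?thesis .
  qed
qed

section \<open>The planar simple random walk\<close>

lemma sum_unit_steps:
  assumes "i \<noteq> j"
  shows "(\<Sum>s\<in>unit_steps {i, j}. f s) =
    f (axis i 1) + f (- axis i 1) + f (axis j 1) + (f (- axis j 1) :: 'b::comm_monoid_add)"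
proof -
  have "axis i (1::int) \<noteq> - axis i 1" "axis j (1::int) \<noteq> - axis j 1"
       "axis i (1::int) \<noteq> axis j 1" "axis i (1::int) \<noteq> - axis j 1" "- axis i (1::int) \<noteq> axis j 1"
    using assms by (auto simp: vec_eq_iff axis_def)
  then have *: "distinct [axis i (1::int), - axis i 1, axis j 1, - axis j 1]"
    by simp
  have "unit_steps {i, j} = set [axis i 1, - axis i 1, axis j 1, - axis j 1]"
    by (auto simp: unit_steps_def)
  with * show ?thesis
    by (simp only: sum.distinct_set_conv_list) (simp add: add.assoc)
qed

lemma finite_unit_steps: "finite (unit_steps I)"
  by (auto simp: unit_steps_def)

lemma card_unit_steps: "i \<noteq> j \<Longrightarrow> card (unit_steps {i, j}) = 4"
  unfolding card_eq_sum by (subst sum_unit_steps) simp_all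

lemma unit_steps_neq_empty: "unit_steps {i, j} \<noteq> {}"
  by (auto simp: unit_steps_def)

section \<open>Reduction to one-dimensional walks\<close>

primrec coin :: "nat \<Rightarrow> int \<Rightarrow> real" where
  "coin 0 x = of_bool (x = 0)"
| "coin (Suc n) x = (coin n (x - 1) + coin n (x + 1)) / 2"

text \<open>In the coordinates \<open>y $ i + y $ j\<close> and \<open>y $ i - y $ j\<close> the planar walk splits into two
  independent one-dimensional walks.\<close>

lemma kernel_unit_steps:
  assumes "i \<noteq> j"
  shows "kernel (unit_steps {i, j}) n y =
    of_bool (\<forall>k. k \<notin> {i, j} \<longrightarrow> y $ k = 0) * coin n (y $ i + y $ j) * coin n (y $ i - y $ j)"
proof (induction n arbitrary: y)
  case 0
  have "y = 0 \<longleftrightarrow> (\<forall>k. k \<notin> {i, j} \<longrightarrow> y $ k = 0) \<and> y $ i + y $ j = 0 \<and> y $ i - y $ j = 0"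
    by (auto simp: vec_eq_iff)
  then show ?case
    by (simp add: kernel_0)
next
  case (Suc n)
  let ?Q = "of_bool (\<forall>k. k \<notin> {i, j} \<longrightarrow> y $ k = 0) :: real"
  let ?a = "y $ i + y $ j" and ?b = "y $ i - y $ j"
  have shift: "kernel (unit_steps {i, j}) n (y - s) = ?Q * coin n (?a - (s $ i + s $ j)) * coin n (?b - (s $ i - s $ j))"
    if "\<And>k. k \<notin> {i, j} \<Longrightarrow> s $ k = 0" for s
  proof -
    have "(\<forall>k. k \<notin> {i, j} \<longrightarrow> (y - s) $ k = 0) \<longleftrightarrow> (\<forall>k. k \<notin> {i, j} \<longrightarrow> y $ k = 0)"
      using that by simp
    moreover have "(y - s) $ i + (y - s) $ j = ?a - (s $ i + s $ j)"
      "(y - s) $ i - (y - s) $ j = ?b - (s $ i - s $ j)"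
      by simp_all
    ultimately show ?thesis
      by (simp only: Suc.IH)
  qed
  \<comment> \<open>The four steps move the pair (\<open>?a\<close>, \<open>?b\<close>) by all four
    combinations of signs, so their average factors into two independent coin steps.\<close>
  have "kernel (unit_steps {i, j}) n (y - axis i 1) = ?Q * coin n (?a - 1) * coin n (?b - 1)"
       "kernel (unit_steps {i, j}) n (y - - axis i 1) = ?Q * coin n (?a + 1) * coin n (?b + 1)"
       "kernel (unit_steps {i, j}) n (y - axis j 1) = ?Q * coin n (?a - 1) * coin n (?b + 1)"
       "kernel (unit_steps {i, j}) n (y - - axis j 1) = ?Q * coin n (?a + 1) * coin n (?b - 1)"
    using assms by (subst shift; simp add: axis_def)+
  then show ?case
    unfolding kernel_Suc sum_unit_steps [OF assms] card_unit_steps [OF assms] coin.simps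
    by (simp add: algebra_simps add_divide_distrib)
qed

text \<open>Reaching \<open>x\<close> in \<open>n\<close> steps takes (n + x)/2 steps upwards, and
  the recursion is Pascal's rule. For \<open>x\<close> above \<open>n\<close> the binomial
  coefficient vanishes by itself; below \<open>- n\<close> the condition is explicit because
  \<open>nat\<close> would truncate to 0.\<close>

lemma coin_eq_binomial:
  "coin n x = (if even (int n + x) \<and> 0 \<le> int n + x
               then real (n choose nat ((int n + x) div 2)) / 2 ^ n else 0)"
proof (induction n arbitrary: x)
  case 0
  show ?case
    by (auto elim!: evenE simp: not_less)
next
  case (Suc n)
  show ?case
  proof (cases "even (int (Suc n) + x) \<and> 0 \<le> int (Suc n) + x")
    case False
    then show ?thesis
      by (auto simp: Suc.IH)
  next
    case True
    then obtain k where k: "int (Suc n) + x = 2 * int k"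
      by (metis evenE zero_le_mult_iff zero_less_numeral nonneg_int_cases not_less mult_less_0_iff order.strict_iff_order)
    \<comment> \<open>Pascal's rule needs a predecessor of \<open>k\<close>, so the leftmost
      reachable point, \<open>k = 0\<close>, is treated separately.\<close>
    show ?thesis
    proof (cases k)
      case 0
      with k have x: "x = - int (Suc n)" by simp
      show ?thesis by (simp add: x Suc.IH)
    next
      case (Suc l)
      have x: "int n + (x - 1) = 2 * int l" "int n + (x + 1) = 2 * int (Suc l)"
          "int (Suc n) + x = 2 * int (Suc l)"
        using k Suc by auto
      have "coin n (x - 1) = real (n choose l) / 2 ^ n"
        unfolding Suc.IH x by simp
      moreover have "coin n (x + 1) = real (n choose Suc l) / 2 ^ n"
        unfolding Suc.IH x by (simp del: of_nat_Suc)
      moreover have "nat ((int (Suc n) + x) div 2) = Suc l"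
        unfolding x by (simp del: of_nat_Suc)
      ultimately show ?thesis
        using True by (simp del: of_nat_Suc add: field_simps)
    qed
  qed
qed

section \<open>Central binomial coefficients and bounds on transition probabilities\<close>

lemma odd_central_binomial_symmetric: "(Suc (2 * m) choose Suc m) = (Suc (2 * m) choose m)"
proof -
  have "Suc (2 * m) - Suc m = m" by simp
  then show ?thesis
    using binomial_symmetric [of "Suc m" "Suc (2 * m)"] by (simp del: binomial_Suc_Suc)
qed

lemma central_binomial_eq_odd: "(2 * Suc m choose Suc m) = 2 * (Suc (2 * m) choose m)"
proof -
  have *: "2 * Suc m = Suc (Suc (2 * m))" by simp
  show ?thesis
    unfolding * binomial_Suc_Suc [of "Suc (2 * m)" m] odd_central_binomial_symmetric
    by (rule mult_2 [symmetric])
qed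

lemma central_binomial_Suc:
  "real (2 * Suc m choose Suc m) / 4 ^ Suc m =
    real (2 * m choose m) / 4 ^ m * ((2 * real m + 1) / (2 * real m + 2))"
proof -
  have "Suc m * (Suc (2 * m) choose m) = Suc (2 * m) * (2 * m choose m)"
    unfolding odd_central_binomial_symmetric [symmetric] by (rule Suc_times_binomial)
  then have "real (Suc m) * real (Suc (2 * m) choose m) = real (Suc (2 * m)) * real (2 * m choose m)"
    unfolding of_nat_mult [symmetric] by (rule arg_cong)
  then have *: "real (Suc (2 * m) choose m) = (2 * real m + 1) * real (2 * m choose m) / (real m + 1)"
    by (simp add: eq_divide_eq add.commute mult.commute del: binomial_Suc_Suc)
  show ?thesis
    unfolding central_binomial_eq_odd of_nat_mult * by (simp add: divide_simps)
qed

text \<open>The left side equals 1 at 0 and does not increase: each step multiplies it by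
  (2m+1)(2m+3)/(2m+2)^2, which is at most 1.\<close>

lemma central_binomial_upper: "(real (2 * m choose m) / 4 ^ m)\<^sup>2 * (2 * real m + 1) \<le> 1"
proof (induction m)
  case (Suc m)
  let ?c = "real (2 * m choose m) / 4 ^ m"
  have "(real (2 * Suc m choose Suc m) / 4 ^ Suc m)\<^sup>2 * (2 * real (Suc m) + 1) =
      ?c\<^sup>2 * (2 * real m + 1) * ((2 * real m + 1) * (2 * real m + 3) / (2 * real m + 2)\<^sup>2)"
    unfolding central_binomial_Suc by (simp add: power_mult_distrib power_divide field_simps power2_eq_square)
  also have "\<dots> \<le> 1 * 1"
  proof (intro mult_mono Suc.IH)
    have "(2 * real m + 1) * (2 * real m + 3) \<le> (2 * real m + 2)\<^sup>2"
      by (simp add: power2_eq_square algebra_simps)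
    then show "(2 * real m + 1) * (2 * real m + 3) / (2 * real m + 2)\<^sup>2 \<le> 1"
      by (simp add: divide_le_eq_1)
  qed simp_all
  finally show ?case by simp
qed simp

text \<open>The right side does not decrease and equals 1 for \<open>m = 0\<close>. The index is
  shifted by \<open>Suc\<close> because the inequality fails for the coefficient at 0.\<close>

lemma central_binomial_lower: "1 \<le> (real (2 * Suc m choose Suc m) / 4 ^ Suc m)\<^sup>2 * (4 * real (Suc m))"
proof (induction m)
  case (Suc m)
  let ?c = "real (2 * Suc m choose Suc m) / 4 ^ Suc m"
  have "1 * 1 \<le> ?c\<^sup>2 * (4 * real (Suc m)) *
      ((2 * real (Suc m) + 1)\<^sup>2 * real (Suc (Suc m)) / ((2 * real (Suc m) + 2)\<^sup>2 * real (Suc m)))"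
  proof (intro mult_mono Suc.IH)
    have "(2 * x + 2)\<^sup>2 * x \<le> (2 * x + 1)\<^sup>2 * (x + 1)" if "x \<ge> 0" for x :: real
      using that by (simp add: power2_eq_square algebra_simps)
    from this [of "real (Suc m)"]
    show "1 \<le> (2 * real (Suc m) + 1)\<^sup>2 * real (Suc (Suc m)) / ((2 * real (Suc m) + 2)\<^sup>2 * real (Suc m))"
      by (subst le_divide_eq_1_pos) (simp_all add: add_ac)
  qed simp_all
  also have "\<dots> = (?c * ((2 * real (Suc m) + 1) / (2 * real (Suc m) + 2)))\<^sup>2 * (4 * real (Suc (Suc m)))"
    by (simp add: power_mult_distrib power_divide divide_simps) (simp add: algebra_simps)
  also have "\<dots> = (real (2 * Suc (Suc m) choose Suc (Suc m)) / 4 ^ Suc (Suc m))\<^sup>2 * (4 * real (Suc (Suc m)))"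
    by (simp only: central_binomial_Suc [of "Suc m"])
  finally show ?case by simp
qed (simp add: power2_eq_square)

lemma coin_nonneg: "0 \<le> coin n x"
  by (simp add: coin_eq_binomial)

lemma coin_le: "(coin n x)\<^sup>2 \<le> 1 / real (Suc n)"
proof -
  \<comment> \<open>Half of \<open>n\<close>, rounded up. For odd \<open>n\<close> the largest
    coefficient divided by 2^n equals the central one of \<open>n + 1\<close> divided by 2^(n+1), so
    both parities reduce to the central coefficient of \<open>2 * m\<close>.\<close>
  define m where "m = Suc n div 2"
  have "coin n x \<le> real (n choose (n div 2)) / 2 ^ n"
    by (auto simp: coin_eq_binomial intro!: divide_right_mono binomial_maximum)
  also have "\<dots> = real (2 * m choose m) / 4 ^ m"
  proof (cases "even n")
    case True
    then show ?thesis
      by (auto elim!: evenE simp: m_def power_mult)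
  next
    case False
    then obtain k where n: "n = Suc (2 * k)"
      by (auto elim!: oddE)
    have "m = Suc k" "n div 2 = k"
      using n by (auto simp: m_def)
    then show ?thesis
      by (simp only: n central_binomial_eq_odd) (simp add: power_mult del: binomial_Suc_Suc)
  qed
  finally have "(coin n x)\<^sup>2 \<le> (real (2 * m choose m) / 4 ^ m)\<^sup>2"
    by (intro power_mono coin_nonneg)
  also have "\<dots> \<le> 1 / (2 * real m + 1)"
    using central_binomial_upper [of m] by (simp add: field_simps)
  also have "\<dots> \<le> 1 / real (Suc n)"
    by (intro divide_left_mono) (auto simp: m_def)
  finally show ?thesis .
qed

text \<open>Each of the two one-dimensional factors has square at most 1/(n+1); their product is
  bounded by the mean of the two squares.\<close>

lemma kernel_le:
  assumes "i \<noteq> j"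
  shows "kernel (unit_steps {i, j}) n y \<le> 1 / real (Suc n)"
proof -
  let ?a = "coin n (y $ i + y $ j)" and ?b = "coin n (y $ i - y $ j)"
  have "2 * (?a * ?b) \<le> ?a\<^sup>2 + ?b\<^sup>2"
    using sum_squares_bound [of ?a ?b] by (simp add: mult.assoc)
  with coin_le [of n "y $ i + y $ j"] coin_le [of n "y $ i - y $ j"]
  have "?a * ?b \<le> 1 / real (Suc n)"
    by simp
  then show ?thesis
    using assms by (auto simp: kernel_unit_steps)
qed

lemma kernel_return_ge:
  assumes "i \<noteq> j" "m > 0"
  shows "1 / (4 * real m) \<le> kernel (unit_steps {i, j}) (2 * m) 0"
proof -
  obtain k where "m = Suc k" using assms gr0_implies_Suc by blast
  with central_binomial_lower [of k] have "1 \<le> (real (2 * m choose m) / 4 ^ m)\<^sup>2 * (4 * real m)"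
    by simp
  then have "1 / (4 * real m) \<le> (real (2 * m choose m) / 4 ^ m)\<^sup>2"
    using assms by (simp add: field_simps)
  also have "real (2 * m choose m) / 4 ^ m = coin (2 * m) 0"
    by (simp add: coin_eq_binomial power_mult)
  finally show ?thesis
    using assms by (simp add: kernel_unit_steps power2_eq_square)
qed

section \<open>Green function and hitting probabilities\<close>

lemma harmonic_sum_le:
  assumes "0 < a" "a \<le> b"
  shows "(\<Sum>m=a..b. 1 / real (Suc m)) \<le> ln (real (Suc b) / real a)"
  using \<open>a \<le> b\<close>
proof (induction b rule: dec_induct)
  case base
  have "1 / real (Suc a) \<le> ln (real (Suc a) / real a)"
    using ln_le_minus_one [of "real a / real (Suc a)"] assms
    by (simp add: ln_div field_simps)
  then show ?case by simp
next
  case (step b)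
  have "1 / real (Suc (Suc b)) \<le> ln (real (Suc (Suc b)) / real (Suc b))"
    using ln_le_minus_one[of "real (Suc b) / real (Suc (Suc b))"]
    by (simp add: ln_div field_simps)
  then show ?case
    using step assms by (simp add: ln_div)
qed

text \<open>The return probabilities at even times dominate a quarter of the harmonic series. This
  logarithmic growth is the gain in \<open>hit_prob_le\<close>, where the hitting probability is
  multiplied by the Green function.\<close>

lemma green_ge:
  assumes "i \<noteq> j"
  shows "ln (real (Suc n)) / 4 \<le> (\<Sum>l\<le>2 * n. kernel (unit_steps {i, j}) l 0)"
proof -
  have "ln (real (Suc n)) \<le> (\<Sum>m=1..n. 1 / real m)"
    using ln_le_harm [of n] by (simp add: harm_def divide_inverse add.commute)
  then have "ln (real (Suc n)) / 4 \<le> (\<Sum>m=1..n. 1 / (4 * real m))"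
    by (simp add: sum_divide_distrib [symmetric] flip: divide_divide_eq_left mult.commute)
  also have "\<dots> \<le> (\<Sum>m=1..n. kernel (unit_steps {i, j}) (2 * m) 0)"
    using assms by (intro sum_mono kernel_return_ge) auto
  also have "\<dots> = (\<Sum>l\<in>(\<lambda>m. 2 * m) ` {1..n}. kernel (unit_steps {i, j}) l 0)"
    by (subst sum.reindex) (auto simp: inj_on_def)
  also have "\<dots> \<le> (\<Sum>l\<le>2 * n. kernel (unit_steps {i, j}) l 0)"
    by (intro sum_mono2) (auto simp: kernel_nonneg)
  finally show ?thesis .
qed

lemma hit_prob_unit_steps_le:
  assumes "i \<noteq> j" "0 < a" "a \<le> 2 * n" "1 < n"
  shows "mean (unit_steps {i, j}) (2 * n)
      (\<lambda>xs. of_bool (\<exists>m\<in>{a..2 * n}. partial_sum xs m = y))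
    \<le> 4 * ln (real (5 * n) / real a) / ln (real n)"
proof -
  have n: "ln (real n) > 0" using assms by simp
  let ?D = "unit_steps {i, j}"
  let ?P = "mean ?D (2 * n) (\<lambda>xs. of_bool (\<exists>m\<in>{a..2 * n}. partial_sum xs m = y))"
  have "ln (real n) / 4 \<le> ln (real (Suc n)) / 4"
    using assms by simp
  then have "?P * (ln (real n) / 4) \<le> ?P * (\<Sum>l\<le>2 * n. kernel ?D l 0)"
    using green_ge [OF assms(1), of n] by (intro mult_left_mono mean_nonneg) auto
  \<comment> \<open>Here \<open>b = c = 2 * n\<close>, so visits are counted up to time
    \<open>4 * n\<close>; the constant 5 below absorbs the successor in
    \<open>Suc (4 * n)\<close>.\<close>
  also have "\<dots> \<le> (\<Sum>m=a..2 * n + 2 * n. kernel ?D m y)"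
    by (intro hit_prob_le finite_unit_steps unit_steps_neq_empty)
  also have "\<dots> \<le> (\<Sum>m=a..2 * n + 2 * n. 1 / real (Suc m))"
    using assms by (intro sum_mono kernel_le)
  also have "\<dots> \<le> ln (real (Suc (2 * n + 2 * n)) / real a)"
    using assms by (intro harmonic_sum_le) auto
  also have "\<dots> \<le> ln (real (5 * n) / real a)"
    using assms by (intro ln_mono divide_right_mono) auto
  finally show ?thesis
    using n by (simp add: field_simps)
qed

section \<open>Self-intersections and the range\<close>

lemma partial_sum_diff:
  assumes "i \<le> j"
  shows "partial_sum xs j = partial_sum xs i + sum_list (take (j - i) (drop i xs))"
proof -
  have "take j xs = take i xs @ take (j - i) (drop i xs)"
    using assms take_add [of i "j - i" xs] by simp
  then show ?thesis by (simp add: partial_sum_def)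
qed

lemma mean_partial_sum_eq:
  fixes D :: "'g::ab_group_add set"
  assumes "finite D" "D \<noteq> {}" "i \<le> j" "j \<le> N"
  shows "mean D N (\<lambda>xs. of_bool (partial_sum xs i = partial_sum xs j)) = kernel D (j - i) 0"
    and "mean D N (\<lambda>xs. of_bool (partial_sum xs j = partial_sum xs i)) = kernel D (j - i) 0"
  using assms mean_drop_take [of D i "j - i" N "\<lambda>xs. of_bool (sum_list xs = 0)"]
  by (simp_all add: partial_sum_diff kernel_def)

text \<open>Cauchy-Schwarz for the multiplicities \<open>c y\<close> of the values: they add up to
  \<open>n\<close>, and their squares add up to the number of ordered pairs of indices with equal
  values.\<close>

lemma square_le_card_image_collisions:
  fixes f :: "nat \<Rightarrow> 'b"
  shows "(real n)\<^sup>2 \<le> real (card (f ` {..<n})) * (\<Sum>i<n. \<Sum>j<n. of_bool (f i = f j))"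
proof -
  let ?R = "f ` {..<n}"
  define c where "c y = (\<Sum>i<n. of_bool (f i = y) :: real)" for y
  have "(\<Sum>y\<in>?R. c y) = (\<Sum>i<n. \<Sum>y\<in>?R. of_bool (f i = y))"
    unfolding c_def by (rule sum.swap)
  also have "\<dots> = (\<Sum>i<n. 1)"
    by (intro sum.cong refl) (simp add: of_bool_def if_distrib cong: if_cong)
  finally have 1: "(\<Sum>y\<in>?R. c y) = real n" by simp
  have "(\<Sum>y\<in>?R. (c y)\<^sup>2) = (\<Sum>y\<in>?R. \<Sum>i<n. \<Sum>j<n. of_bool (f i = y) * of_bool (f j = y))"
    by (simp only: c_def power2_eq_square sum_product)
  also have "\<dots> = (\<Sum>i<n. \<Sum>y\<in>?R. \<Sum>j<n. of_bool (f i = y) * of_bool (f j = y))"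
    by (rule sum.swap)
  also have "\<dots> = (\<Sum>i<n. \<Sum>j<n. \<Sum>y\<in>?R. of_bool (f i = y) * of_bool (f j = y))"
    by (intro sum.cong refl sum.swap)
  also have "\<dots> = (\<Sum>i<n. \<Sum>j<n. of_bool (f i = f j))"
  proof (intro sum.cong refl)
    fix i j assume "i \<in> {..<n}"
    have "(\<Sum>y\<in>?R. of_bool (f i = y) * of_bool (f j = y)) = (\<Sum>y\<in>?R. if f i = y then of_bool (f j = f i) else 0 :: real)"
      by (intro sum.cong) auto
    also have "\<dots> = of_bool (f i = f j)"
      using \<open>i \<in> {..<n}\<close> by (auto simp: eq_commute)
    finally show "(\<Sum>y\<in>?R. of_bool (f i = y) * of_bool (f j = y)) = (of_bool (f i = f j) :: real)" .
  qed
  finally have 2: "(\<Sum>y\<in>?R. (c y)\<^sup>2) = (\<Sum>i<n. \<Sum>j<n. of_bool (f i = f j))" .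
  show ?thesis
    using sum_squared_le_sum_of_squares [of c ?R] unfolding 1 2 by (simp add: mult.commute)
qed

lemma green_le:
  assumes "i \<noteq> j" "0 < n"
  shows "(\<Sum>l<n. kernel (unit_steps {i, j}) l 0) \<le> 1 + ln (real n)"
proof -
  have "(\<Sum>l<n. kernel (unit_steps {i, j}) l 0) \<le> (\<Sum>l<n. 1 / real (Suc l))"
    using assms by (intro sum_mono kernel_le)
  also have "\<dots> \<le> 1 + ln (real n)"
  proof (cases "n = 1")
    case False
    then have "{..<n} = insert 0 {1..n - 1}" "1 \<le> n - 1"
      using assms by auto
    then show ?thesis
      using harmonic_sum_le [of 1 "n - 1"] assms by simp
  qed simp
  finally show ?thesis .
qed

text \<open>Increments are stationary, so a pair of times contributes the return probability for
  their distance. For fixed \<open>k\<close> the earlier and the later times each give at most one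
  truncated Green function.\<close>

lemma mean_collisions_le:
  assumes "i \<noteq> j" "0 < n" "n \<le> N"
  shows "mean (unit_steps {i, j}) N
      (\<lambda>xs. \<Sum>k<n. \<Sum>l<n. of_bool (partial_sum xs k = partial_sum xs l))
    \<le> 2 * real n * (1 + ln (real n))"
proof -
  let ?D = "unit_steps {i, j}"
  note D = finite_unit_steps unit_steps_neq_empty
  have row: "(\<Sum>l<n. mean ?D N (\<lambda>xs. of_bool (partial_sum xs k = partial_sum xs l)))
      \<le> 2 * (1 + ln (real n))" if "k < n" for k
  proof -
    have eq: "{..<n} = {..<k} \<union> {k..<n}" using that by auto
    have "(\<Sum>l<n. mean ?D N (\<lambda>xs. of_bool (partial_sum xs k = partial_sum xs l)))
       = (\<Sum>l<k. kernel ?D (k - l) 0) + (\<Sum>l=k..<n. kernel ?D (l - k) 0)"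
      unfolding eq using assms that
      by (subst sum.union_disjoint) (auto simp: mean_partial_sum_eq [OF D])
    also have "\<dots> \<le> (1 + ln (real n)) + (1 + ln (real n))"
    proof (rule add_mono)
      show "(\<Sum>l<k. kernel ?D (k - l) 0) \<le> 1 + ln (real n)"
      proof -
        have "(\<Sum>l<k. kernel ?D (k - l) 0) = (\<Sum>l\<in>(\<lambda>l. k - l) ` {..<k}. kernel ?D l 0)"
          by (subst sum.reindex) (auto simp: inj_on_def)
        also have "\<dots> \<le> (\<Sum>l<n. kernel ?D l 0)"
          using that by (intro sum_mono2) (auto simp: kernel_nonneg)
        finally show ?thesis
          using green_le [OF assms(1,2)] by linarith
      qed
      show "(\<Sum>l=k..<n. kernel ?D (l - k) 0) \<le> 1 + ln (real n)"
      proof -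
        have "(\<Sum>l=k..<n. kernel ?D (l - k) 0) = (\<Sum>l\<in>(\<lambda>l. l - k) ` {k..<n}. kernel ?D l 0)"
          by (subst sum.reindex) (auto simp: inj_on_def)
        also have "\<dots> \<le> (\<Sum>l<n. kernel ?D l 0)"
          using that by (intro sum_mono2) (auto simp: kernel_nonneg)
        finally show ?thesis
          using green_le [OF assms(1,2)] by linarith
      qed
    qed
    finally show ?thesis by simp
  qed
  have "mean ?D N (\<lambda>xs. \<Sum>k<n. \<Sum>l<n. of_bool (partial_sum xs k = partial_sum xs l))
      \<le> (\<Sum>k<n. 2 * (1 + ln (real n)))"
    unfolding mean_sum using row by (intro sum_mono) auto
  then show ?thesis by (simp add: algebra_simps)
qed

text \<open>A range below \<open>t\<close> forces at least n^2/t collisions by Cauchy-Schwarz;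
  Markov's inequality bounds the probability of that.\<close>

lemma small_range_prob_le:
  assumes "i \<noteq> j" "0 < n" "n \<le> N" "0 < t"
  shows "mean (unit_steps {i, j}) N (\<lambda>xs. of_bool (real (card (partial_sum xs ` {..<n})) < t))
    \<le> 2 * t * (1 + ln (real n)) / real n"
proof -
  let ?D = "unit_steps {i, j}"
  let ?c = "\<lambda>xs :: (int ^ 4) list. \<Sum>k<n. \<Sum>l<n. of_bool (partial_sum xs k = partial_sum xs l) :: real"
  have "(real n)\<^sup>2 / t \<le> ?c xs" if "real (card (partial_sum xs ` {..<n})) < t" for xs
  proof -
    have "(real n)\<^sup>2 \<le> real (card (partial_sum xs ` {..<n})) * ?c xs"
      by (rule square_le_card_image_collisions)
    also have "\<dots> \<le> t * ?c xs"
      using that by (intro mult_right_mono sum_nonneg) auto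
    finally show ?thesis
      using assms by (simp add: field_simps)
  qed
  then have "mean ?D N (\<lambda>xs. of_bool (real (card (partial_sum xs ` {..<n})) < t))
      \<le> mean ?D N (\<lambda>xs. of_bool ((real n)\<^sup>2 / t \<le> ?c xs))"
    by (intro mean_mono) auto
  also have "\<dots> \<le> mean ?D N ?c / ((real n)\<^sup>2 / t)"
    using assms by (intro mean_markov sum_nonneg) auto
  also have "\<dots> \<le> 2 * real n * (1 + ln (real n)) / ((real n)\<^sup>2 / t)"
    using assms by (intro divide_right_mono mean_collisions_le) auto
  also have "\<dots> = 2 * t * (1 + ln (real n)) / real n"
    using assms by (simp add: power2_eq_square)
  finally show ?thesis .
qed

section \<open>Backtracking steps\<close>

lemma uminus_unit_steps: "a \<in> unit_steps I \<Longrightarrow> - a \<in> unit_steps I"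
  by (auto simp: unit_steps_def)

text \<open>The weight is 2 to the minus number of backtracks among \<open>J\<close> disjoint pairs
  of steps. The pairs are independent and each backtracks with probability 1/4, giving the factor
  3/4 + 1/8 = 7/8.\<close>

lemma mean_backtrack_weight:
  fixes D :: "'g::ab_group_add set"
  assumes "card D = 4" "\<And>a. a \<in> D \<Longrightarrow> - a \<in> D"
  shows "mean D (2 * J) (\<lambda>xs. \<Prod>j<J. if xs ! (2 * j) + xs ! Suc (2 * j) = 0 then 1 / 2 else 1) = (7 / 8) ^ J"
proof (induction J)
  case (Suc J)
  have D: "finite D"
    using assms(1) card.infinite by fastforce
  let ?w = "\<lambda>a b :: 'g. if a + b = 0 then 1 / 2 else 1 :: real"
  let ?p = "\<lambda>J xs. \<Prod>j<J. ?w (xs ! (2 * j)) (xs ! Suc (2 * j))"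
  have w: "(\<Sum>b\<in>D. ?w a b) = 7 / 2" if "a \<in> D" for a
  proof -
    have "(\<Sum>b\<in>D. ?w a b) = (\<Sum>b\<in>D. 1 - (if - a = b then 1 / 2 else 0))"
      by (intro sum.cong) (auto simp: neg_eq_iff_add_eq_0)
    also have "\<dots> = 7 / 2"
      using that assms D by (simp add: sum_subtractf)
    finally show ?thesis .
  qed
  have "mean D (2 * Suc J) (?p (Suc J)) =
      (\<Sum>a\<in>D. (\<Sum>b\<in>D. mean D (2 * J) (\<lambda>xs. ?w a b * ?p J xs)) / 4) / 4"
    by (simp add: assms prod.lessThan_Suc_shift del: prod.lessThan_Suc)
  also have "\<dots> = (\<Sum>a\<in>D. (\<Sum>b\<in>D. ?w a b * (7 / 8) ^ J) / 4) / 4"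
    by (simp only: mean_cmult Suc.IH)
  also have "\<dots> = (\<Sum>a\<in>D. 7 / 2 * (7 / 8) ^ J / 4) / 4"
    unfolding sum_distrib_right [symmetric] by (simp only: w cong: sum.cong)
  also have "\<dots> = (7 / 8) ^ Suc J"
    using assms by simp
  finally show ?case .
qed simp

text \<open>A Chernoff bound: with fewer than \<open>t\<close> backtracks, \<open>2 ^ t\<close>
  times the weight of \<open>mean_backtrack_weight\<close> is at least 1.\<close>

lemma few_backtracks_prob_le:
  assumes "i \<noteq> j" "2 * J \<le> N"
  shows "mean (unit_steps {i, j}) N
      (\<lambda>xs. of_bool (card {l. l < J \<and> partial_sum xs (2 * l + 2) = partial_sum xs (2 * l)} < t))
    \<le> 2 ^ t * (7 / 8) ^ J"
proof -
  let ?D = "unit_steps {i, j}"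
  let ?B = "\<lambda>xs :: (int ^ 4) list. {l. l < J \<and> partial_sum xs (2 * l + 2) = partial_sum xs (2 * l)}"
  let ?p = "\<lambda>xs :: (int ^ 4) list. \<Prod>l<J. if xs ! (2 * l) + xs ! Suc (2 * l) = 0 then 1 / 2 else 1 :: real"
  have p: "?p xs = (1 / 2) ^ card (?B xs)" if "length xs = N" for xs
  proof -
    have "xs ! (2 * l) + xs ! Suc (2 * l) = 0 \<longleftrightarrow> partial_sum xs (2 * l + 2) = partial_sum xs (2 * l)"
      if "l < J" for l
      using that \<open>length xs = N\<close> assms by (simp add: partial_sum_Suc add.assoc)
    then have "?p xs = (\<Prod>l<J. if l \<in> ?B xs then 1 / 2 else 1)"
      by (intro prod.cong) auto
    also have "\<dots> = (\<Prod>l\<in>{..<J} \<inter> ?B xs. 1 / 2)"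
      by (subst prod.inter_restrict) auto
    also have "{..<J} \<inter> ?B xs = ?B xs" by auto
    finally show ?thesis by simp
  qed
  have "mean ?D N (\<lambda>xs. of_bool (card (?B xs) < t)) \<le> mean ?D N (\<lambda>xs. 2 ^ t * ?p xs)"
  proof (rule mean_mono)
    fix xs :: "(int ^ 4) list" assume "length xs = N"
    have "1 \<le> (2::real) ^ t * (1 / 2) ^ card (?B xs)" if "card (?B xs) < t"
      using that power_increasing [of "card (?B xs)" t "2::real"]
      by (simp add: power_divide)
    then show "of_bool (card (?B xs) < t) \<le> 2 ^ t * ?p xs"
      unfolding p [OF \<open>length xs = N\<close>] by auto
  qed
  also have "\<dots> = 2 ^ t * mean ?D N (\<lambda>xs. ?p (take (2 * J) xs))"
    unfolding mean_cmult by (intro arg_cong [where f = "\<lambda>x. 2 ^ t * x"] mean_cong prod.cong) auto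
  also have "\<dots> = 2 ^ t * mean ?D (2 * J) ?p"
    by (simp only: mean_take [of ?D "2 * J" N ?p, OF finite_unit_steps unit_steps_neq_empty assms(2)])
  also have "\<dots> = 2 ^ t * (7 / 8) ^ J"
    using mean_backtrack_weight [OF card_unit_steps [OF assms(1)] uminus_unit_steps, of J] by simp
  finally show ?thesis .
qed

section \<open>The law of the history\<close>

text \<open>Histories are stored with the latest site first, so \<open>hd h\<close> is the current
  position and extending a history is a \<open>Cons\<close>.\<close>

definition fresh :: "'g list \<Rightarrow> bool" where
  "fresh h \<longleftrightarrow> hd h \<notin> set (tl h)"

definition directions :: "(int ^ 4) list \<Rightarrow> (int ^ 4) set" where
  "directions h = (if fresh h then unit_steps {1, 2} else unit_steps {3, 4})"

text \<open>Expectation of \<open>f\<close> applied to the history \<open>n\<close> steps after the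
  history is \<open>h\<close>. The position alone is not Markovian, but the history is, so the
  recursion runs over histories.\<close>

primrec walk_mean :: "nat \<Rightarrow> ((int ^ 4) list \<Rightarrow> real) \<Rightarrow> (int ^ 4) list \<Rightarrow> real" where
  "walk_mean 0 f h = f h"
| "walk_mean (Suc n) f h = (\<Sum>v\<in>directions h. walk_mean n f ((hd h + v) # h)) / 4"

definition history :: "(nat \<Rightarrow> 'a \<Rightarrow> 'b) \<Rightarrow> nat \<Rightarrow> 'a \<Rightarrow> 'b list" where
  "history S n \<omega> = map (\<lambda>i. S i \<omega>) (rev [0..<Suc n])"

lemma history_Suc: "history S (Suc n) \<omega> = S (Suc n) \<omega> # history S n \<omega>"
  by (simp add: history_def)

lemma hd_history: "hd (history S n \<omega>) = S n \<omega>"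
  by (simp add: history_def)

lemma fresh_history: "fresh (history S n \<omega>) \<longleftrightarrow> first_visit S n \<omega>"
  by (simp add: fresh_def history_def first_visit_def lessThan_atLeast0)

lemma history_eq_iff:
  "length h = Suc m \<Longrightarrow> history S m \<omega> = h \<longleftrightarrow> (\<forall>k\<le>m. S k \<omega> = h ! (m - k))"
proof (induction m arbitrary: h)
  case 0
  then show ?case by (cases h) (auto simp: history_def)
next
  case (Suc m)
  then obtain x h' where h: "h = x # h'" "length h' = Suc m"
    by (cases h) auto
  have "(\<forall>k\<le>Suc m. S k \<omega> = h ! (Suc m - k)) \<longleftrightarrow>
      S (Suc m) \<omega> = x \<and> (\<forall>k\<le>m. S k \<omega> = h' ! (m - k))"
    by (auto simp: h le_Suc_eq Suc_diff_le)
  then show ?case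
    using Suc.IH [OF h(2)] by (simp add: history_Suc h)
qed

lemma finite_directions: "finite (directions h)"
  by (simp add: directions_def finite_unit_steps)

lemma card_directions: "card (directions h) = 4"
  by (simp add: directions_def card_unit_steps)

section \<open>Joint law of the histories of the process\<close>

context M22_random_walk
begin

lemma measurable_steps [measurable]: "S n \<in> measurable M (count_space UNIV)"
  by (rule measurable_walk)

lemma history_event:
  assumes "length h = Suc m"
  shows "{\<omega> \<in> space M. history S m \<omega> = h} \<in> sets (hist_algebra M S m)"
proof -
  have "{\<omega> \<in> space M. history S m \<omega> = h} = (\<Inter>k\<in>{..m}. S k -` {h ! (m - k)} \<inter> space M)"
    by (auto simp: history_eq_iff [OF assms])
  also have "\<dots> \<in> sets (hist_algebra M S m)"
  proof (rule sets.finite_INT)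
    fix k assume "k \<in> {..m}"
    then have "S k -` {h ! (m - k)} \<inter> space M \<in> {S k -` A \<inter> space M | k A. k \<le> m}"
      by blast
    then show "S k -` {h ! (m - k)} \<inter> space M \<in> sets (hist_algebra M S m)"
      unfolding hist_algebra_def by (intro sets.sigma_sets_subset in_measure_of) auto
  qed auto
  finally show ?thesis .
qed

lemma history_measurable [measurable]:
  assumes "length h = Suc m"
  shows "{\<omega> \<in> space M. history S m \<omega> = h} \<in> events"
  using history_event [OF assms] subalgebra_hist_algebra [of S M m] measurable_walk
  by (auto simp: subalgebra_def)

text \<open>The event that the history is \<open>h\<close> lies in
  \<open>hist_algebra M S m\<close>, and on it \<open>h\<close> decides whether the site is fresh.
  Integrating the conditional probability, almost surely 1/4 there, over this event gives the
  claim.\<close>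

lemma prob_next_step:
  assumes "length h = Suc m" "v \<in> directions h"
  shows "prob {\<omega> \<in> space M. history S m \<omega> = h \<and> S (Suc m) \<omega> - S m \<omega> = v} =
    prob {\<omega> \<in> space M. history S m \<omega> = h} / 4"
proof -
  let ?F = "hist_algebra M S m"
  let ?E = "{\<omega> \<in> space M. history S m \<omega> = h}"
  let ?B = "{\<omega> \<in> space M. S (Suc m) \<omega> - S m \<omega> = v}"
  interpret F: finite_measure_subalgebra M ?F
    by unfold_locales (rule subalgebra_hist_algebra [OF measurable_walk])
  have E: "?E \<in> sets ?F" "?E \<in> events"
    using history_event history_measurable assms by auto
  have B: "?B \<in> events"
    by measurable
  have ae: "AE \<omega> in M. \<omega> \<in> ?E \<longrightarrow> step_prob M S m v \<omega> = 1 / 4"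
  proof (cases "fresh h")
    case True
    then show ?thesis
      using step_first_visit [of v m] assms(2) fresh_history [of S m]
      by (auto simp: directions_def elim!: eventually_mono)
  next
    case False
    then show ?thesis
      using step_revisit [of v m] assms(2) fresh_history [of S m]
      by (auto simp: directions_def elim!: eventually_mono)
  qed
  have "{\<omega> \<in> space M. history S m \<omega> = h \<and> S (Suc m) \<omega> - S m \<omega> = v} = ?E \<inter> ?B"
    by auto
  then have "prob {\<omega> \<in> space M. history S m \<omega> = h \<and> S (Suc m) \<omega> - S m \<omega> = v} = (\<integral>\<omega>\<in>?E. indicator ?B \<omega> \<partial>M)"
    using E B by (simp add: set_lebesgue_integral_def flip: indicator_inter_arith)
  also have "\<dots> = (\<integral>\<omega>\<in>?E. step_prob M S m v \<omega> \<partial>M)"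
    unfolding step_prob_def using E B
    by (intro F.real_cond_exp_intA) (auto simp: less_top [symmetric])
  also have "\<dots> = (\<integral>\<omega>\<in>?E. 1 / 4 \<partial>M)"
    unfolding set_lebesgue_integral_def
  proof (rule integral_cong_AE)
    show "AE \<omega> in M. indicator ?E \<omega> *\<^sub>R step_prob M S m v \<omega> = indicator ?E \<omega> *\<^sub>R (1 / 4)"
      using ae by eventually_elim (auto simp: indicator_def)
  qed (use E in \<open>auto simp: step_prob_def\<close>)
  also have "\<dots> = prob ?E / 4"
    using E by (simp add: set_lebesgue_integral_def)
  finally show ?thesis .
qed

text \<open>The Markov property of the history process, by conditioning on the next step.\<close>

lemma prob_history:
  assumes "{\<omega> \<in> space M. Q (history S (m + n) \<omega>)} \<in> events" "length h = Suc m"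
  shows "prob {\<omega> \<in> space M. history S m \<omega> = h \<and> Q (history S (m + n) \<omega>)} =
    prob {\<omega> \<in> space M. history S m \<omega> = h} * walk_mean n (\<lambda>h. of_bool (Q h)) h"
  using assms
proof (induction n arbitrary: m h)
  case 0
  have "{\<omega> \<in> space M. history S m \<omega> = h \<and> Q (history S m \<omega>)} =
      (if Q h then {\<omega> \<in> space M. history S m \<omega> = h} else {})"
    by auto
  then show ?case by simp
next
  case (Suc n)
  let ?E = "{\<omega> \<in> space M. history S m \<omega> = h}"
  let ?Q = "{\<omega> \<in> space M. Q (history S (m + Suc n) \<omega>)}"
  let ?B = "\<lambda>v. {\<omega> \<in> space M. history S m \<omega> = h \<and> S (Suc m) \<omega> - S m \<omega> = v}"
  have B_eq: "?B v = {\<omega> \<in> space M. history S (Suc m) \<omega> = (hd h + v) # h}" for v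
    using hd_history [of S m] by (auto simp: history_Suc algebra_simps)
  have meas: "?E \<in> events" "?Q \<in> events" "\<And>v. ?B v \<in> events"
    using Suc.prems history_measurable [of h m] history_measurable [of "(hd h + v) # h" "Suc m" for v]
    by (auto simp only: B_eq) auto
  have disj: "disjoint_family_on (\<lambda>v. ?B v \<inter> A) (directions h)" for A
    by (auto simp: disjoint_family_on_def)
  have UB: "(\<Union>v\<in>directions h. ?B v) \<in> events" "(\<Union>v\<in>directions h. ?B v) \<subseteq> ?E"
    using meas finite_directions by auto
  \<comment> \<open>The assumptions prescribe the probabilities of the four allowed steps only. As
    these already exhaust the probability of \<open>?E\<close>, any other step has probability
    0.\<close>
  have "prob (\<Union>v\<in>directions h. ?B v) = (\<Sum>v\<in>directions h. prob (?B v))"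
    using meas finite_directions disj [of UNIV] by (intro finite_measure_finite_Union) auto
  also have "\<dots> = prob ?E"
    using Suc.prems by (simp add: prob_next_step card_directions)
  finally have "prob (?E - (\<Union>v\<in>directions h. ?B v)) = 0"
    using UB meas finite_measure_Diff [of ?E "\<Union>v\<in>directions h. ?B v"] by simp
  then have null: "prob ((?E - (\<Union>v\<in>directions h. ?B v)) \<inter> ?Q) = 0"
    using UB meas finite_measure_mono [of "(?E - (\<Union>v\<in>directions h. ?B v)) \<inter> ?Q" "?E - (\<Union>v\<in>directions h. ?B v)"]
    by (auto intro!: antisym)
  have "?E \<inter> ?Q = (\<Union>v\<in>directions h. ?B v \<inter> ?Q) \<union> ((?E - (\<Union>v\<in>directions h. ?B v)) \<inter> ?Q)"
    by auto
  then have "prob (?E \<inter> ?Q) = prob (\<Union>v\<in>directions h. ?B v \<inter> ?Q) + prob ((?E - (\<Union>v\<in>directions h. ?B v)) \<inter> ?Q)"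
    using UB meas finite_directions
    by (simp only:) (intro finite_measure_Union, auto)
  also have "\<dots> = (\<Sum>v\<in>directions h. prob (?B v \<inter> ?Q))"
    unfolding null using meas finite_directions disj by (subst finite_measure_finite_Union) auto
  also have "\<dots> = (\<Sum>v\<in>directions h. prob ?E / 4 * walk_mean n (\<lambda>h. of_bool (Q h)) ((hd h + v) # h))"
  proof (intro sum.cong refl)
    fix v assume v: "v \<in> directions h"
    have "?B v \<inter> ?Q = {\<omega> \<in> space M. history S (Suc m) \<omega> = (hd h + v) # h \<and> Q (history S (Suc m + n) \<omega>)}"
      unfolding B_eq by auto
    then have "prob (?B v \<inter> ?Q) = prob (?B v) * walk_mean n (\<lambda>h. of_bool (Q h)) ((hd h + v) # h)"
      using Suc.IH [of "Suc m" "(hd h + v) # h"] Suc.prems unfolding B_eq by simp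
    then show "prob (?B v \<inter> ?Q) = prob ?E / 4 * walk_mean n (\<lambda>h. of_bool (Q h)) ((hd h + v) # h)"
      using prob_next_step [OF Suc.prems(2) v] by simp
  qed
  also have "\<dots> = prob ?E * walk_mean (Suc n) (\<lambda>h. of_bool (Q h)) h"
    by (simp add: sum_distrib_left sum_divide_distrib)
  also have "?E \<inter> ?Q = {\<omega> \<in> space M. history S m \<omega> = h \<and> Q (history S (m + Suc n) \<omega>)}"
    by auto
  finally show ?case .
qed

lemma prob_eq_walk_mean:
  assumes "{\<omega> \<in> space M. Q (history S n \<omega>)} \<in> events"
  shows "prob {\<omega> \<in> space M. Q (history S n \<omega>)} = walk_mean n (\<lambda>h. of_bool (Q h)) [0]"
proof -
  have "AE \<omega> in M. history S 0 \<omega> = [0]"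
    using start by (simp add: history_def)
  then have "prob {\<omega> \<in> space M. Q (history S n \<omega>)} =
      prob {\<omega> \<in> space M. history S 0 \<omega> = [0] \<and> Q (history S n \<omega>)}"
    using assms history_measurable [of "[0]" 0]
    by (intro finite_measure_eq_AE) auto
  also have "\<dots> = prob {\<omega> \<in> space M. history S 0 \<omega> = [0]} * walk_mean n (\<lambda>h. of_bool (Q h)) [0]"
    using prob_history [of Q 0 n "[0]"] assms by simp
  also have "prob {\<omega> \<in> space M. history S 0 \<omega> = [0]} = 1"
    using \<open>AE \<omega> in M. history S 0 \<omega> = [0]\<close> history_measurable [of "[0]" 0]
    by (subst prob_Collect_eq_1) auto
  finally show ?thesis by simp
qed

end

text \<open>Each new step is taken off one of the two lists \<open>us\<close> and \<open>vs\<close>. If these are uniformly distributed,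
  the history is distributed like that of the walk, and \<open>us\<close>, \<open>vs\<close> are independent.\<close>

definition advance :: "'g::plus list \<times> 'g list \<times> 'g list \<Rightarrow> 'g list \<times> 'g list \<times> 'g list" where
  "advance = (\<lambda>(h, us, vs).
     if fresh h then ((hd h + hd us) # h, tl us, vs) else ((hd h + hd vs) # h, us, tl vs))"

text \<open>Whichever list supplies the next step, its tail is again uniform and independent of the
  other list. Since each step shortens only one of the lists, the induction needs independent
  lengths \<open>i\<close> and \<open>j\<close>. For a revisit, the average over the head of
  \<open>vs\<close> is moved out of the outer mean over \<open>us\<close>.\<close>

lemma walk_mean_eq_mean:
  assumes "n \<le> i" "n \<le> j"
  shows "walk_mean n f h = mean (unit_steps {1, 2}) i (\<lambda>us. mean (unit_steps {3, 4}) j (\<lambda>vs.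
    f (fst ((advance ^^ n) (h, us, vs)))))"
  using assms
proof (induction n arbitrary: h i j)
  case 0
  show ?case
    by (simp add: mean_const finite_unit_steps unit_steps_neq_empty)
next
  case (Suc n)
  obtain i' j' where ij: "i = Suc i'" "j = Suc j'"
    using Suc.prems by (metis Suc_le_D)
  show ?case
  proof (cases "fresh h")
    case True
    then show ?thesis
      using Suc.prems ij
      by (simp add: directions_def card_unit_steps funpow_Suc_right advance_def Suc.IH [of i' j]
          del: funpow.simps)
  next
    case False
    then show ?thesis
      using Suc.prems ij
      by (simp add: directions_def card_unit_steps funpow_Suc_right advance_def Suc.IH [of i j']
          mean_sum mean_divide del: funpow.simps)
  qed
qed

lemma history_advance:
  fixes us vs :: "'g::ab_group_add list"
  assumes "length us = N" "length vs = N"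
  obtains S r where
    "r 0 = 0"
    "\<And>m. r (Suc m) = r m + of_bool (S m \<notin> S ` {..<m})"
    "\<And>m. m \<le> N \<Longrightarrow> S m = partial_sum us (r m) + partial_sum vs (m - r m)"
    "fst ((advance ^^ N) ([0], us, vs)) = map S (rev [0..<Suc N])"
proof -
  define st where "st m = (advance ^^ m) ([0], us, vs)" for m
  \<comment> \<open>\<open>S\<close> and \<open>r\<close> are defined at all times, so the recursion
    for \<open>r\<close> holds without restriction. Beyond \<open>N\<close> a list may be exhausted
    and \<open>hd []\<close> is unspecified; hence the formula for \<open>S\<close> is claimed up to
    \<open>N\<close> only.\<close>
  define S where "S m = hd (fst (st m))" for m
  define r where "r m = (\<Sum>l<m. of_bool (S l \<notin> S ` {..<l}) :: nat)" for m
  have r_le: "r m \<le> m" for m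
    using sum_mono [of "{..<m}" "\<lambda>l. of_bool (S l \<notin> S ` {..<l}) :: nat" "\<lambda>_. 1"] by (simp add: r_def)
  have st_Suc: "st (Suc m) = advance (st m)" for m
    by (simp add: st_def)
  have hist: "fst (st m) = map S (rev [0..<Suc m])" for m
  proof (induction m)
    case 0
    show ?case by (simp add: st_def S_def)
  next
    case (Suc m)
    have "fst (st (Suc m)) = S (Suc m) # fst (st m)"
      by (simp add: S_def st_Suc advance_def split: prod.split)
    then show ?case using Suc.IH by simp
  qed
  have fresh: "fresh (fst (st m)) \<longleftrightarrow> S m \<notin> S ` {..<m}" for m
    by (simp add: hist fresh_def lessThan_atLeast0)
  \<comment> \<open>Invariant: exactly \<open>r m\<close> entries of \<open>us\<close> and
    \<open>m - r m\<close> entries of \<open>vs\<close> have been consumed.\<close>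
  have st: "st m = (fst (st m), drop (r m) us, drop (m - r m) vs) \<and>
      S m = partial_sum us (r m) + partial_sum vs (m - r m)" if "m \<le> N" for m
    using that
  proof (induction m)
    case 0
    show ?case by (simp add: st_def S_def r_def)
  next
    case (Suc m)
    then have IH: "st m = (fst (st m), drop (r m) us, drop (m - r m) vs)"
      "S m = partial_sum us (r m) + partial_sum vs (m - r m)" and m: "m < N"
      by auto
    have hd: "hd (fst (st m)) = S m" by (simp add: S_def)
    have lt: "r m < length us" "m - r m < length vs"
      using r_le [of m] m assms by auto
    show ?case
    proof (cases "fresh (fst (st m))")
      case True
      then have r: "r (Suc m) = Suc (r m)" "Suc m - r (Suc m) = m - r m"
        using fresh by (auto simp: r_def)
      have *: "st (Suc m) = ((S m + us ! r m) # fst (st m), drop (Suc (r m)) us, drop (m - r m) vs)"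
        unfolding st_Suc by (subst IH(1)) (use True lt hd in
          \<open>simp add: advance_def hd_drop_conv_nth tl_drop drop_Suc\<close>)
      then have "S (Suc m) = S m + us ! r m" by (simp add: S_def)
      with * show ?thesis
        unfolding r using lt by (simp add: IH(2) partial_sum_Suc add_ac)
    next
      case False
      then have r: "r (Suc m) = r m" "Suc m - r m = Suc (m - r m)"
        using fresh r_le [of m] by (auto simp: r_def)
      have *: "st (Suc m) = ((S m + vs ! (m - r m)) # fst (st m), drop (r m) us, drop (Suc (m - r m)) vs)"
        unfolding st_Suc by (subst IH(1)) (use False lt hd in
          \<open>simp add: advance_def hd_drop_conv_nth tl_drop drop_Suc\<close>)
      then have "S (Suc m) = S m + vs ! (m - r m)" by (simp add: S_def)
      with * show ?thesis
        unfolding r using lt by (simp add: IH(2) partial_sum_Suc add_ac)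
    qed
  qed
  show thesis
  proof (rule that)
    show "fst ((advance ^^ N) ([0], us, vs)) = map S (rev [0..<Suc N])"
      using hist [of N] by (simp add: st_def)
    show "r (Suc m) = r m + of_bool (S m \<notin> S ` {..<m})" for m
      unfolding r_def by (rule sum.lessThan_Suc)
    show "r 0 = 0"
      by (simp add: r_def)
  qed (use st in blast)
qed

section \<open>Numbers of steps of the two components\<close>

text \<open>The deterministic part: \<open>r m\<close> counts the first visits before time
  \<open>m\<close>, and \<open>U\<close> advances exactly at these times, \<open>V\<close> at the
  others.\<close>

locale two_component_walk =
  fixes U V S :: "nat \<Rightarrow> 'g::ab_group_add" and r :: "nat \<Rightarrow> nat" and N :: nat
  assumes r_0: "r 0 = 0"
    and r_Suc: "\<And>m. r (Suc m) = r m + of_bool (S m \<notin> S ` {..<m})"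
    and S_eq: "\<And>m. m \<le> N \<Longrightarrow> S m = U (r m) + V (m - r m)"
begin

lemma mono_r: "k \<le> m \<Longrightarrow> r k \<le> r m"
  by (rule lift_Suc_mono_le [of r]) (simp_all add: r_Suc)

lemma r_eq_card: "r m = card (S ` {..<m})"
  by (induction m) (auto simp: r_0 r_Suc lessThan_Suc card_insert_if)

lemma diff_r_eq_card: "m - r m = card {l. l < m \<and> S l \<in> S ` {..<l}}" and r_le: "r m \<le> m"
proof -
  have "r m + card {l. l < m \<and> S l \<in> S ` {..<l}} = m"
  proof (induction m)
    case (Suc m)
    have "{l. l < Suc m \<and> S l \<in> S ` {..<l}} =
        (if S m \<in> S ` {..<m} then insert m {l. l < m \<and> S l \<in> S ` {..<l}} else {l. l < m \<and> S l \<in> S ` {..<l}})"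
      by (auto simp: less_Suc_eq)
    then show ?case using Suc by (simp add: r_Suc)
  qed (simp add: r_0)
  then show "m - r m = card {l. l < m \<and> S l \<in> S ` {..<l}}" "r m \<le> m"
    by linarith+
qed

text \<open>Each time \<open>V\<close> is about to advance, its current value is the projection of
  the current site. So every value of \<open>V\<close> already left behind is the projection of some
  visited site, and there are \<open>r m\<close> visited sites.\<close>

lemma card_range_le:
  assumes "m \<le> N" and proj: "\<And>k l. p (U k + V l) = V l"
  shows "card (V ` {..<m - r m}) \<le> r m"
proof -
  have "V ` {..<m - r m} \<subseteq> p ` S ` {..<m}"
    using \<open>m \<le> N\<close>
  proof (induction m)
    case (Suc m)
    show ?case
    proof (cases "S m \<in> S ` {..<m}")
      case True
      have "Suc m - r (Suc m) = Suc (m - r m)"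
        using True r_le [of m] by (simp add: r_Suc Suc_diff_le del: image_iff)
      moreover have "V (m - r m) = p (S m)"
        using Suc.prems by (simp add: S_eq proj)
      ultimately show ?thesis
        using Suc by (auto simp: lessThan_Suc)
    next
      case False
      then have "Suc m - r (Suc m) = m - r m"
        by (simp add: r_Suc)
      then show ?thesis
        using Suc by (auto simp: lessThan_Suc)
    qed
  qed simp
  then have "card (V ` {..<m - r m}) \<le> card (p ` S ` {..<m})"
    by (intro card_mono) auto
  also have "\<dots> \<le> r m"
    unfolding r_eq_card by (rule card_image_le) simp
  finally show ?thesis .
qed

lemma obtain_first_visit:
  assumes "k < r m"
  obtains t where "t < m" "r t = k" "r (Suc t) = Suc k"
proof -
  have "\<exists>t<m. r t = k \<and> r (Suc t) = Suc k"
    using assms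
  proof (induction m)
    case (Suc m)
    show ?case
    proof (cases "k < r m")
      case True
      then show ?thesis using Suc.IH less_Suc_eq by blast
    next
      case False
      then have "r m = k" "r (Suc m) = Suc k"
        using Suc.prems by (auto simp: r_Suc of_bool_def split: if_splits)
      then show ?thesis by blast
    qed
  qed (simp add: r_0)
  then show thesis using that by blast
qed

text \<open>Let \<open>t\<close> be the time at which \<open>U\<close> leaves index
  \<open>2 * l\<close>. Either the next site is old, or it is new; then \<open>U\<close> moves again
  at once and the walk is back at \<open>S t\<close>. Both cases produce a revisit.\<close>

lemma card_backtracks_le:
  assumes "m \<le> N"
  shows "card {l. 2 * l + 2 < r m \<and> U (2 * l + 2) = U (2 * l)} \<le> m - r m"
proof -
  let ?R = "{l. l < m \<and> S l \<in> S ` {..<l}}"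
  \<comment> \<open>At that revisit \<open>r\<close> is \<open>2 * l + 1\<close> or
    \<open>2 * l + 2\<close>, so \<open>l\<close> can be recovered from its time and distinct
    backtracks give distinct revisits. The strict bound \<open>2 * l + 2 < r m\<close> places the
    revisit before \<open>m\<close>.\<close>
  have "{l. 2 * l + 2 < r m \<and> U (2 * l + 2) = U (2 * l)} \<subseteq> (\<lambda>t. (r t - 1) div 2) ` ?R"
  proof clarify
    fix l assume l: "2 * l + 2 < r m" "U (2 * l + 2) = U (2 * l)"
    have lt: "t < m" if "r t < r m" for t
      using that mono_r [of m t] by linarith
    from l have "2 * l < r m" by simp
    then obtain t where t: "t < m" "r t = 2 * l" "r (Suc t) = Suc (2 * l)"
      using obtain_first_visit by blast
    show "l \<in> (\<lambda>t. (r t - 1) div 2) ` ?R"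
    proof (cases "S (Suc t) \<in> S ` {..<Suc t}")
      case True
      moreover have "Suc t < m" using lt [of "Suc t"] t l by simp
      ultimately show ?thesis using t by (intro image_eqI [of _ _ "Suc t"]) auto
    next
      case False
      then have r: "r (Suc (Suc t)) = 2 * l + 2"
        using t by (simp add: r_Suc [of "Suc t"])
      then have "Suc (Suc t) < m" using lt l by simp
      moreover from this have "S (Suc (Suc t)) = S t"
        using S_eq [of t] S_eq [of "Suc (Suc t)"] assms t r l(2) by simp
      then have "S (Suc (Suc t)) \<in> S ` {..<Suc (Suc t)}"
        by (intro image_eqI [of _ _ t]) auto
      ultimately show ?thesis using r by (intro image_eqI [of _ _ "Suc (Suc t)"]) auto
    qed
  qed
  then have "card {l. 2 * l + 2 < r m \<and> U (2 * l + 2) = U (2 * l)} \<le> card ((\<lambda>t. (r t - 1) div 2) ` ?R)"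
    by (intro card_mono) auto
  also have "\<dots> \<le> card ?R"
    by (rule card_image_le) simp
  finally show ?thesis by (simp add: diff_r_eq_card)
qed

text \<open>As \<open>m\<close> is at least \<open>2 * h\<close>, one of \<open>r m\<close> and
  \<open>m - r m\<close> is at least \<open>h\<close>. If it is the one to be bounded, nothing
  remains to be shown; otherwise the other component has made \<open>h\<close> steps, and its range
  or its backtracks give the bound.\<close>

lemma component_times:
  assumes "2 * h \<le> m" "m \<le> N" and proj: "\<And>k l. p (U k + V l) = V l"
    and range: "L \<le> card (V ` {..<h})" "L \<le> h"
    and backtracks: "t \<le> card {l. l < J \<and> U (2 * l + 2) = U (2 * l)}" "t \<le> h" "2 * J < h"
  shows "L \<le> r m" "t \<le> m - r m"
proof -
  show "L \<le> r m"
  proof (cases "h \<le> m - r m")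
    case True
    have "card (V ` {..<h}) \<le> card (V ` {..<m - r m})"
      using True by (intro card_mono image_mono) auto
    also have "\<dots> \<le> r m"
      by (rule card_range_le [where p = p, OF \<open>m \<le> N\<close> proj])
    finally show ?thesis using range by simp
  qed (use assms(1) range(2) backtracks(2) in linarith)
  show "t \<le> m - r m"
  proof (cases "h \<le> r m")
    case True
    have "card {l. l < J \<and> U (2 * l + 2) = U (2 * l)}
        \<le> card {l. 2 * l + 2 < r m \<and> U (2 * l + 2) = U (2 * l)}"
      using True backtracks
      by (intro card_mono finite_subset [of "{l. 2 * l + 2 < r m \<and> U (2 * l + 2) = U (2 * l)}" "{..r m}"]) auto
    also have "\<dots> \<le> m - r m"
      using assms by (intro card_backtracks_le)
    finally show ?thesis using backtracks by simp
  qed (use assms(1) range(2) backtracks(2) in linarith)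
qed

end

section \<open>Transience\<close>

definition coord_part :: "'n set \<Rightarrow> int ^ 'n \<Rightarrow> int ^ 'n" where
  "coord_part I z = (\<chi> i. if i \<in> I then z $ i else 0)"

lemma coord_part_add: "coord_part I (y + z) = coord_part I y + coord_part I z"
  by (simp add: coord_part_def vec_eq_iff)

lemma coord_part_zero [simp]: "coord_part I 0 = 0"
  by (simp add: coord_part_def vec_eq_iff)

lemma coord_part_partial_sum:
  assumes "set xs \<subseteq> unit_steps I"
  shows "coord_part I (partial_sum xs n) = partial_sum xs n"
    and "I \<inter> J = {} \<Longrightarrow> coord_part J (partial_sum xs n) = 0"
proof -
  have 1: "coord_part I v = v" "I \<inter> J = {} \<Longrightarrow> coord_part J v = 0" if "v \<in> unit_steps I" for v
    using that by (auto simp: unit_steps_def coord_part_def vec_eq_iff axis_def)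
  have 2: "coord_part I (sum_list ys) = sum_list ys" "I \<inter> J = {} \<Longrightarrow> coord_part J (sum_list ys) = 0"
    if "set ys \<subseteq> unit_steps I" for ys
    using that by (induction ys) (auto simp: coord_part_add 1)
  have "set (take n xs) \<subseteq> unit_steps I"
    using assms set_take_subset by fast
  then show "coord_part I (partial_sum xs n) = partial_sum xs n"
    "I \<inter> J = {} \<Longrightarrow> coord_part J (partial_sum xs n) = 0"
    by (simp_all add: 2 partial_sum_def)
qed

text \<open>At a visit at time \<open>m\<close> the two lists hit the two parts of \<open>z\<close>
  at their own times \<open>r m\<close> and \<open>m - r m\<close>, which
  \<open>component_times\<close> bounds from below.\<close>

lemma visit_imp_components:
  fixes us vs :: "(int ^ 4) list" and h L t J :: nat
  defines "N \<equiv> 4 * h"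
  assumes "length us = N" "set us \<subseteq> unit_steps {1, 2}"
    and "length vs = N" "set vs \<subseteq> unit_steps {3, 4}"
    and visit: "\<exists>m\<in>{2 * h..N}. rev (fst ((advance ^^ N) ([0], us, vs))) ! m = z"
    and range: "L \<le> card (partial_sum vs ` {..<h})" "L \<le> h"
    and backtracks: "t \<le> card {l. l < J \<and> partial_sum us (2 * l + 2) = partial_sum us (2 * l)}"
      "t \<le> h" "2 * J < h"
  shows "(\<exists>k\<in>{L..N}. partial_sum us k = coord_part {1, 2} z) \<and>
    (\<exists>k\<in>{t..N}. partial_sum vs k = coord_part {3, 4} z)"
proof -
  obtain S r where r: "r 0 = 0" "\<And>m. r (Suc m) = r m + of_bool (S m \<notin> S ` {..<m})"
    and S: "\<And>m. m \<le> N \<Longrightarrow> S m = partial_sum us (r m) + partial_sum vs (m - r m)"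
    and hist: "fst ((advance ^^ N) ([0], us, vs)) = map S (rev [0..<Suc N])"
    by (rule history_advance [OF assms(2,4)]) (rule that)
  interpret two_component_walk "partial_sum us" "partial_sum vs" S r N
    using r S by unfold_locales
  obtain m where m: "2 * h \<le> m" "m \<le> N" "rev (map S (rev [0..<Suc N])) ! m = z"
    using visit unfolding hist by auto
  then have z: "z = partial_sum us (r m) + partial_sum vs (m - r m)"
    using S by (simp add: rev_map del: upt_Suc)
  have disj: "{1, 2} \<inter> {3, 4::4} = {}" "{3, 4} \<inter> {1, 2::4} = {}"
    by auto
  note parts = coord_part_partial_sum [OF assms(3)] coord_part_partial_sum [OF assms(5)]
  have proj: "coord_part {3, 4} (partial_sum us k + partial_sum vs l) = partial_sum vs l"
    "coord_part {1, 2} (partial_sum us k + partial_sum vs l) = partial_sum us k" for k l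
    using disj by (simp_all add: coord_part_add parts)
  have "L \<le> r m" "t \<le> m - r m"
    using component_times [where p = "coord_part {3, 4}", OF m(1,2) proj(1) range backtracks] .
  moreover have "r m \<le> N" "m - r m \<le> N"
    using m(2) r_le [of m] by linarith+
  ultimately show ?thesis
    using z proj by auto
qed

text \<open>A union bound: a visit requires both components to hit their targets late, unless there
  are too few backtracks or the range is too small.\<close>

lemma walk_mean_visit_le:
  fixes h L t J :: nat
  assumes h: "1 < h" and L: "0 < L" "L \<le> h" and t: "0 < t" "t \<le> h" and J: "2 * J < h"
  shows "walk_mean (4 * h) (\<lambda>hs. of_bool (\<exists>m\<in>{2 * h..4 * h}. rev hs ! m = z)) [0]
    \<le> 4 * ln (real (10 * h) / real L) / ln (real (2 * h)) *
        (4 * ln (real (10 * h) / real t) / ln (real (2 * h)))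
      + 2 ^ t * (7 / 8) ^ J + 2 * real L * (1 + ln (real h)) / real h"
proof -
  let ?N = "4 * h"
  let ?D = "unit_steps {1, 2}" and ?E = "unit_steps {3, 4}"
  note D = finite_unit_steps unit_steps_neq_empty
  let ?HU = "\<lambda>us. of_bool (\<exists>k\<in>{L..?N}. partial_sum us k = coord_part {1, 2} z) :: real"
  let ?HV = "\<lambda>vs. of_bool (\<exists>k\<in>{t..?N}. partial_sum vs k = coord_part {3, 4} z) :: real"
  let ?BU = "\<lambda>us :: (int ^ 4) list.
    of_bool (card {l. l < J \<and> partial_sum us (2 * l + 2) = partial_sum us (2 * l)} < t) :: real"
  let ?BV = "\<lambda>vs :: (int ^ 4) list. of_bool (real (card (partial_sum vs ` {..<h})) < real L) :: real"
  have "walk_mean ?N (\<lambda>hs. of_bool (\<exists>m\<in>{2 * h..?N}. rev hs ! m = z)) [0]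
    = mean ?D ?N (\<lambda>us. mean ?E ?N (\<lambda>vs.
        of_bool (\<exists>m\<in>{2 * h..?N}. rev (fst ((advance ^^ ?N) ([0], us, vs))) ! m = z)))"
    by (rule walk_mean_eq_mean) simp_all
  also have "\<dots> \<le> mean ?D ?N (\<lambda>us. mean ?E ?N (\<lambda>vs. ?HU us * ?HV vs + ?BU us + ?BV vs))"
  proof (intro mean_mono)
    fix us vs :: "(int ^ 4) list"
    assume uv: "length us = ?N" "set us \<subseteq> ?D" "length vs = ?N" "set vs \<subseteq> ?E"
    show "of_bool (\<exists>m\<in>{2 * h..?N}. rev (fst ((advance ^^ ?N) ([0], us, vs))) ! m = z)
        \<le> ?HU us * ?HV vs + ?BU us + ?BV vs"
    proof (cases "(\<exists>m\<in>{2 * h..?N}. rev (fst ((advance ^^ ?N) ([0], us, vs))) ! m = z) \<and>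
        L \<le> card (partial_sum vs ` {..<h}) \<and>
        t \<le> card {l. l < J \<and> partial_sum us (2 * l + 2) = partial_sum us (2 * l)}")
      case True
      then have "?HU us = 1" "?HV vs = 1"
        using visit_imp_components [OF uv, of z L t J] L t J by auto
      then show ?thesis by simp
    next
      case False
      then have "\<not> (\<exists>m\<in>{2 * h..?N}. rev (fst ((advance ^^ ?N) ([0], us, vs))) ! m = z) \<or> ?BV vs = 1 \<or> ?BU us = 1"
        by (simp add: not_le)
      then show ?thesis
        by (elim disjE) (simp_all add: add_nonneg_nonneg)
    qed
  qed
  \<comment> \<open>Independence of the two lists turns the joint hitting probability into a
    product.\<close>
  also have "\<dots> = mean ?D ?N ?HU * mean ?E ?N ?HV + mean ?D ?N ?BU + mean ?E ?N ?BV"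
    by (simp only: mean_add mean_cmult mean_cmult_right mean_const [OF D])
  also have "\<dots> \<le> 4 * ln (real (10 * h) / real L) / ln (real (2 * h)) *
        (4 * ln (real (10 * h) / real t) / ln (real (2 * h)))
      + 2 ^ t * (7 / 8) ^ J + 2 * real L * (1 + ln (real h)) / real h"
  proof (intro add_mono mult_mono)
    show "mean ?D ?N ?HU \<le> 4 * ln (real (10 * h) / real L) / ln (real (2 * h))"
      using hit_prob_unit_steps_le [of 1 2 L "2 * h" "coord_part {1, 2} z"] h L by simp
    show "mean ?E ?N ?HV \<le> 4 * ln (real (10 * h) / real t) / ln (real (2 * h))"
      using hit_prob_unit_steps_le [of 3 4 t "2 * h" "coord_part {3, 4} z"] h t by simp
    show "mean ?D ?N ?BU \<le> 2 ^ t * (7 / 8) ^ J"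
      using J by (intro few_backtracks_prob_le) auto
    show "mean ?E ?N ?BV \<le> 2 * real L * (1 + ln (real h)) / real h"
      using h L by (intro small_range_prob_le) auto
    show "0 \<le> 4 * ln (real (10 * h) / real L) / ln (real (2 * h))"
      using h L by (intro divide_nonneg_nonneg mult_nonneg_nonneg ln_ge_zero) auto
  qed (auto intro: mean_nonneg)
  finally show ?thesis .
qed

text \<open>Bounds the probability of a visit to a given site during \<open>[2\<^bsup>p+6\<^esup>, 2\<^bsup>p+7\<^esup>]\<close>. The summands account for
  both components hitting their targets, for too few backtracks of \<open>U\<close> and for a small range of \<open>V\<close>.\<close>

definition visit_bound :: "nat \<Rightarrow> real" where
  "visit_bound p = 4 * ln (10 * (real p + 1) ^ 3) / (ln 2 * (real p + 6)) * (4 * 320 / (ln 2 * (real p + 6)))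
    + (7 / 10) ^ p + 2 * (1 / (real p + 1) ^ 3 + 1 / 2 ^ (p + 5)) * (1 + ln 2 * (real p + 5))"

text \<open>The hitting term is of order (log p)/p^2 and the range term of order p^(-2); the
  exponent 3/2 leaves room for the logarithm.\<close>

lemma summable_visit_bound: "summable visit_bound"
proof (rule summable_comparison_test_bigo)
  show "summable (\<lambda>n. norm (real n powr - (3 / 2)))"
    by (simp add: summable_real_powr_iff)
  show "visit_bound \<in> O(\<lambda>n. real n powr - (3 / 2))"
    unfolding visit_bound_def by (intro sum_in_bigo; real_asymp)
qed

lemma walk_mean_visit_le_visit_bound:
  assumes "1 \<le> p"
  shows "walk_mean (2 ^ (p + 7)) (\<lambda>hs. of_bool (\<exists>m\<in>{2 ^ (p + 6)..2 ^ (p + 7)}. rev hs ! m = z)) [0]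
    \<le> visit_bound p"
proof -
  \<comment> \<open>\<open>L\<close> is about h/(p+1)^3: small enough for a range failure of order
    p^(-2), yet with \<open>h / L\<close> polynomial in \<open>p\<close>, so that its logarithm is
    of order log p. The \<open>Suc\<close> ensures \<open>0 < L\<close> and
    \<open>h < L * c\<close>. As \<open>t\<close> is \<open>h / 32\<close>, the other ratio
    \<open>10 * h / t\<close> is the constant 320.\<close>
  define h :: nat where "h = 2 ^ (p + 5)"
  define c :: nat where "c = (p + 1) ^ 3"
  define L where "L = Suc (h div c)"
  define t :: nat where "t = 2 ^ p"
  have h: "2 * h = 2 ^ (p + 6)" "4 * h = 2 ^ (p + 7)" "h = 32 * t"
    by (simp_all add: h_def t_def power_add)
  have t: "0 < t" "p < t" by (simp_all add: t_def)
  have c: "8 \<le> c"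
    using power_mono [of 2 "p + 1" 3] assms by (simp add: c_def add.commute)
  have c_real: "real c = (real p + 1) ^ 3" by (simp add: c_def add.commute)
  have "h div c \<le> h div 8"
    using c by (intro div_le_mono2) auto
  then have L: "0 < L" "L \<le> h"
    using h t by (auto simp: L_def)
  have "h < L * c"
    using dividend_less_times_div [of c h] c by (simp add: L_def algebra_simps)
  then have L_ge: "real h \<le> real L * real c"
    by (simp flip: of_nat_mult)
  have "real L / real h = real (h div c) / real h + 1 / real h"
    by (simp add: L_def add_divide_distrib)
  also have "\<dots> \<le> real h / real c / real h + 1 / real h"
    by (intro add_right_mono divide_right_mono of_nat_div_le_of_nat) simp
  finally have L_le: "real L / real h \<le> 1 / real c + 1 / real h"
    by (simp add: h_def)
  have h_real: "real h = 2 ^ (p + 5)" "real (2 * h) = 2 ^ (p + 6)"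
    unfolding h(1) by (simp_all only: h_def of_nat_power of_nat_numeral)
  have ln_h: "ln (real h) = ln 2 * (real p + 5)" "ln (real (2 * h)) = ln 2 * (real p + 6)"
    unfolding h_real by (simp_all only: ln_realpow of_nat_add of_nat_numeral mult.commute)
  \<comment> \<open>The number of step pairs is \<open>J = 8 * t\<close>, admissible since 16t < 32t
    = h.\<close>
  have "walk_mean (2 ^ (p + 7)) (\<lambda>hs. of_bool (\<exists>m\<in>{2 ^ (p + 6)..2 ^ (p + 7)}. rev hs ! m = z)) [0]
    \<le> 4 * ln (real (10 * h) / real L) / ln (real (2 * h)) *
        (4 * ln (real (10 * h) / real t) / ln (real (2 * h)))
      + 2 ^ t * (7 / 8) ^ (8 * t) + 2 * real L * (1 + ln (real h)) / real h"
    unfolding h(1,2) [symmetric] using h t L by (intro walk_mean_visit_le) auto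
  also have "\<dots> \<le> visit_bound p"
    unfolding visit_bound_def
  proof (intro add_mono mult_mono)
    have "real (10 * h) / real L \<le> 10 * real c"
      using L_ge L by (simp add: field_simps)
    then show "4 * ln (real (10 * h) / real L) / ln (real (2 * h)) \<le>
        4 * ln (10 * (real p + 1) ^ 3) / (ln 2 * (real p + 6))"
      unfolding ln_h c_real [symmetric] using L h t
      by (intro divide_right_mono mult_left_mono ln_mono) auto
    \<comment> \<open>Only a constant is needed, so ln 320 is bounded crudely through ln x <= x -
      1.\<close>
    show "4 * ln (real (10 * h) / real t) / ln (real (2 * h)) \<le> 4 * 320 / (ln 2 * (real p + 6))"
      unfolding ln_h using h t ln_le_minus_one [of "320 :: real"]
      by (intro divide_right_mono mult_left_mono) auto
    have "2 ^ t * (7 / 8) ^ (8 * t) = (2 * (7 / 8) ^ 8 :: real) ^ t"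
      by (simp add: power_mult power_mult_distrib)
    \<comment> \<open>Numerically 2 * (7/8)^8 is about 0.687; this is why \<open>J\<close> is taken
      as large as \<open>8 * t\<close>.\<close>
    also have "\<dots> \<le> (7 / 10) ^ t"
      by (intro power_mono) (simp_all add: power_divide)
    also have "\<dots> \<le> (7 / 10) ^ p"
      using t by (intro power_decreasing) auto
    finally show "2 ^ t * (7 / 8) ^ (8 * t) \<le> ((7 / 10) ^ p :: real)" .
    have "2 * real L * (1 + ln (real h)) / real h = 2 * (real L / real h) * (1 + ln (real h))"
      by simp
    also have "\<dots> \<le> 2 * (1 / real c + 1 / real h) * (1 + ln (real h))"
      using L_le h t by (intro mult_right_mono mult_left_mono) auto
    finally show "2 * real L * (1 + ln (real h)) / real h \<le>
        2 * (1 / (real p + 1) ^ 3 + 1 / 2 ^ (p + 5)) * (1 + ln 2 * (real p + 5))"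
      unfolding c_real [symmetric] h_real(1) [symmetric] ln_h(1) [symmetric] .
    show "0 \<le> 4 * ln (10 * (real p + 1) ^ 3) / (ln 2 * (real p + 6))"
      by (intro divide_nonneg_nonneg mult_nonneg_nonneg ln_ge_zero) (use c c_real in auto)
    show "0 \<le> 4 * ln (real (10 * h) / real t) / ln (real (2 * h))"
      using h t by (intro divide_nonneg_nonneg mult_nonneg_nonneg ln_ge_zero) auto
  qed
  finally show ?thesis .
qed

section \<open>Borel-Cantelli over dyadic blocks of time\<close>

lemma countable_UNIV_vec4: "countable (UNIV :: (int ^ 4) set)"
proof (rule countableI')
  show "inj (\<lambda>z :: int ^ 4. [z $ 1, z $ 2, z $ 3, z $ 4])"
    by (auto intro!: injI simp: vec_eq_iff forall_4)
qed

theorem theorem1: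
  fixes M :: "'a measure" and S :: "nat \<Rightarrow> 'a \<Rightarrow> int ^ 4"
  assumes "M22_random_walk M S"
  shows "AE \<omega> in M. \<forall>z. finite {n. S n \<omega> = z}"
proof -
  interpret M22_random_walk M S by fact
  have "AE \<omega> in M. finite {n. S n \<omega> = z}" for z
  proof -
    \<comment> \<open>The dyadic blocks together cover all times from 2^6 on.\<close>
    define A where "A p = {\<omega> \<in> space M. \<exists>m\<in>{2 ^ (p + 6)..2 ^ (p + 7)}. S m \<omega> = z}" for p :: nat
    have A [measurable]: "A p \<in> events" for p
      unfolding A_def by measurable
    have "prob (A p) \<le> visit_bound p" if "1 \<le> p" for p
    proof -
      have nth: "rev (history S n \<omega>) ! m = S m \<omega>" if "m \<le> n" for m n \<omega>
        using that by (simp add: history_def rev_map del: upt_Suc)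
      have eq: "A p = {\<omega> \<in> space M. \<exists>m\<in>{2 ^ (p + 6)..2 ^ (p + 7)}. rev (history S (2 ^ (p + 7)) \<omega>) ! m = z}"
        unfolding A_def by (intro Collect_cong conj_cong bex_cong refl) (simp add: nth)
      then show ?thesis
        using prob_eq_walk_mean [of "\<lambda>hs. \<exists>m\<in>{2 ^ (p + 6)..2 ^ (p + 7)}. rev hs ! m = z" "2 ^ (p + 7)"]
          A [of p] walk_mean_visit_le_visit_bound [OF that, of z] by simp
    qed
    then have "summable (\<lambda>p. prob (A p))"
      by (intro summable_comparison_test' [OF summable_visit_bound, of 1]) simp
    then have "AE \<omega> in M. eventually (\<lambda>p. \<omega> \<in> space M - A p) sequentially"
      by (intro borel_cantelli_AE1) (auto simp: emeasure_eq_measure)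
    then show ?thesis
    proof (rule AE_mp, intro AE_I2 impI)
      fix \<omega> assume "\<omega> \<in> space M" "eventually (\<lambda>p. \<omega> \<in> space M - A p) sequentially"
      then obtain P where P: "\<And>p m. P \<le> p \<Longrightarrow> m \<in> {2 ^ (p + 6)..2 ^ (p + 7)} \<Longrightarrow> S m \<omega> \<noteq> z"
        unfolding eventually_sequentially A_def by blast
      \<comment> \<open>A later visit at time \<open>m\<close>, with 2^q <= m < 2^(q+1), would lie
        in the block with index \<open>q - 6\<close>, which is at least \<open>P\<close>.\<close>
      have "m < 2 ^ (P + 6)" if "S m \<omega> = z" for m
      proof (rule ccontr)
        assume m: "\<not> m < 2 ^ (P + 6)"
        then have "1 \<le> m"
          using one_le_power [of "2::nat" "P + 6"] by linarith
        then obtain q where q: "2 ^ q \<le> m" "m < 2 ^ (q + 1)"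
          using ex_power_ivl1 [of 2 m] by auto
        then have "(2::nat) ^ (P + 6) < 2 ^ (q + 1)"
          using m by linarith
        then have "P + 6 < q + 1"
          by (rule power_less_imp_less_exp [rotated]) simp
        then have "q = (q - 6) + 6" "P \<le> q - 6"
          by linarith+
        moreover from this q have "m \<in> {2 ^ (q - 6 + 6)..2 ^ (q - 6 + 7)}"
          by (simp add: add.commute)
        ultimately show False
          using P [of "q - 6" m] that by blast
      qed
      then have "{n. S n \<omega> = z} \<subseteq> {..<2 ^ (P + 6)}"
        by blast
      then show "finite {n. S n \<omega> = z}"
        by (rule finite_subset) simp
    qed
  qed
  \<comment> \<open>There are only countably many sites, so the exceptional null sets can be
    united.\<close>
  then have "AE \<omega> in M. \<forall>z\<in>UNIV. finite {n. S n \<omega> = z}"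
    by (subst AE_ball_countable [OF countable_UNIV_vec4]) simp
  then show ?thesis by simp
qed

end
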